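(* Let $\tilde g\in\mathrm{PSL}(3,\mathbb{H})$ be a parabolic transformation, let $g\in\mathrm{SL}(3,\mathbb{H})$ be a lift of $\tilde g$, and let $G=\langle\tilde g\rangle$. Below, $\alpha,\beta\in\mathbb{R}$. The Kulkarni sets of $G$ are the following. (i) (Vertical translation) If $g=\begin{pmatrix}1&1&0\\0&1&0\\0&0&1\end{pmatrix}$, then $L_0(G)=\mathbb{L}\{e_1,e_3\}$, $L_1(G)=\{e_1\}$ and $L_2(G)=\{e_1\}$. (ii) (Non-vertical translation) If $g=\begin{pmatrix}1&1&0\\0&1&1\\0&0&1\end{pmatrix}$, then $L_0(G)=\{e_1\}$, $L_1(G)=\{e_1\}$ and $L_2(G)=\mathbb{L}\{e_1,e_2\}$. (iii) (Ellipto-parabolic) If $g=\begin{pmatrix}e^{2\pi i\alpha}&1&0\\0&e^{2\pi i\alpha}&0\\0&0&e^{2\pi i\beta}\end{pmatrix}$ with $e^{2\pi i\alpha}\neq1$, then $L_2(G)=\{e_1\}$ and: (a) (Rational ellipto-parabolic) if $\alpha,\beta\in\mathbb{Q}$, then $L_0(G)=\mathbb{L}\{e_1,e_3\}$ and $L_1(G)=\{e_1\}$; (b) (Irrational ellipto-parabolic) if either or both of $\alpha$ and $\beta$ are in $\mathbb{R}\setminus\mathbb{Q}$, then $L_0(G)=\{e_1,e_3\}$ and $L_1(G)=\mathbb{L}\{e_1,e_3\}$. (iv) (Ellipto-translation) If $g=\begin{pmatrix}e^{2\pi i\alpha}&1&0\\0&e^{2\pi i\alpha}&1\\0&0&e^{2\pi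 i\alpha}\end{pmatrix}$, then $L_0(G)=L_1(G)=\{e_1\}$ and $L_2(G)=\mathbb{L}\{e_1,e_2\}$.
   Context: $\mathbb{H}$ denotes Hamilton's quaternions, with $\mathbb{C}=\mathbb{R}\oplus\mathbb{R}i\subset\mathbb{H}$. $\mathbb{H}^3$ is a right $\mathbb{H}$-vector space, and $\mathbb{P}^2_{\mathbb{H}}$ is the quotient of $\mathbb{H}^3\setminus\{0\}$ by $z\sim z\alpha$ for $\alpha\in\mathbb{H}\setminus\{0\}$; the class of $(x,y,z)$ is $[x:y:z]$. $e_1=[1:0:0]$, $e_2=[0:1:0]$, $e_3=[0:0:1]$. For distinct $p,q\in\mathbb{P}^2_{\mathbb{H}}$, $\mathbb{L}\{p,q\}$ is the quaternionic projective line through $p$ and $q$ (the image of the 2-dimensional right $\mathbb{H}$-subspace spanned by representatives). $\mathrm{SL}(3,\mathbb{H})$ is the group of $3\times 3$ quaternionic matrices $A=A_1+A_2j$ ($A_1,A_2$ complex) for which the complex $6\times 6$ matrix $\begin{pmatrix}A_1&A_2\\-\overline{A_2}&\overline{A_1}\end{pmatrix}$ has determinant $1$; it acts on $\mathbb{P}^2_{\mathbb{H}}$ by left matrix multiplication on column vectors. $\mathrm{PSL}(3,\mathbb{H})=\mathrm{SL}(3,\mathbb{H})/\{\pm \mathrm{I}_3\}$, and a lift of $\tilde g\in\mathrm{PSL}(3,\mathbb{H})$ is a matrix in $\mathrm{SL}(3,\mathbb{H})$ projecting to $\tilde g$. An element is parabolic if it is not semisimple and all its eigenvalue similarity classes are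 represented by complex numbers of modulus $1$. For a family $\{A_\beta\}_{\beta\in B}$ of subsets of $X=\mathbb{P}^2_{\mathbb{H}}$, a point $p\in X$ is a cluster point if every neighbourhood of $p$ intersects $A_\beta$ for infinitely many $\beta\in B$. For a group $G$ acting on $X$, with isotropy groups $G_x=\{g\in G\mid gx=x\}$, the Kulkarni sets are: $L_0(G)$, the closure of the set of points of $X$ with infinite isotropy group; $L_1(G)$, the closure of the set of cluster points of orbits $\{g(x)\}_{g\in G}$ of points $x\in X\setminus L_0(G)$; $L_2(G)$, the closure of the set of cluster points of families $\{g(K)\}_{g\in G}$, where $K$ runs over all compact subsets of $X\setminus(L_0(G)\cup L_1(G))$.
   Formalization: In (iii)(b), L_0(G) = {e_1, e_3} is asserted only when α+β and α−β are both irrational; otherwise a power of g fixes all [w:0:1] with w in C (α−β rational) or in Cj (α+β rational), so the claim as printed fails, e.g. for α = β irrational. *)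

theory Defs
  imports "HOL-Analysis.Analysis" "HOL-Algebra.Generated_Groups"
begin

section \<open>Hamilton's quaternions\<close>

text \<open>\<^term>\<open>Quat a b\<close> stands for \<open>a + b j\<close> with \<open>a\<close>, \<open>b\<close> complex; the product is the one
  determined by \<open>j * j = - 1\<close> and \<open>j * c = cnj c * j\<close> for complex \<open>c\<close>.\<close>

datatype quat = Quat (qfst: complex) (qsnd: complex)

lemma quat_eq_iff: "p = q \<longleftrightarrow> qfst p = qfst q \<and> qsnd p = qsnd q"
  by (cases p; cases q) auto

definition qc :: "complex \<Rightarrow> quat" where
  "qc c = Quat c 0"

instantiation quat :: real_normed_div_algebra
begin

definition "0 = Quat 0 0"
definition "1 = Quat 1 0"
definition "p + q = Quat (qfst p + qfst q) (qsnd p + qsnd q)"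
definition "p - q = Quat (qfst p - qfst q) (qsnd p - qsnd q)"
definition "- q = Quat (- qfst q) (- qsnd q)"
definition "p * q = Quat (qfst p * qfst q - qsnd p * cnj (qsnd q))
                         (qfst p * qsnd q + qsnd p * cnj (qfst q))"
definition scaleR_quat where "scaleR_quat r q = Quat (r *\<^sub>R qfst q) (r *\<^sub>R qsnd q)"
definition norm_quat where "norm_quat q = sqrt ((cmod (qfst q))\<^sup>2 + (cmod (qsnd q))\<^sup>2)"
definition inverse_quat where
  "inverse_quat q = Quat (cnj (qfst q) / complex_of_real ((norm q)\<^sup>2))
                         (- qsnd q / complex_of_real ((norm q)\<^sup>2))"
definition divide_quat where "divide_quat p (q :: quat) = p * inverse q"
definition sgn_quat where "sgn_quat q = Quat (qfst q /\<^sub>R norm q) (qsnd q /\<^sub>R norm q)"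
definition dist_quat where "dist_quat p q = norm (p - q :: quat)"
definition uniformity_quat where
  "(uniformity :: (quat \<times> quat) filter) = (INF e\<in>{0<..}. principal {(x, y). dist x y < e})"
definition open_quat where
  "open_quat (U :: quat set) \<longleftrightarrow>
    (\<forall>x\<in>U. eventually (\<lambda>(x', y). x' = x \<longrightarrow> y \<in> U) uniformity)"

lemma quat_sel [simp]:
  "qfst 0 = 0" "qsnd 0 = 0" "qfst 1 = 1" "qsnd 1 = 0"
  "qfst (p + q) = qfst p + qfst q" "qsnd (p + q) = qsnd p + qsnd q"
  "qfst (p - q) = qfst p - qfst q" "qsnd (p - q) = qsnd p - qsnd q"
  "qfst (- q) = - qfst q" "qsnd (- q) = - qsnd q"
  "qfst (p * q) = qfst p * qfst q - qsnd p * cnj (qsnd q)"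
  "qsnd (p * q) = qfst p * qsnd q + qsnd p * cnj (qfst q)"
  "qfst (r *\<^sub>R q) = r *\<^sub>R qfst q" "qsnd (r *\<^sub>R q) = r *\<^sub>R qsnd q"
  by (simp_all add: zero_quat_def one_quat_def plus_quat_def minus_quat_def uminus_quat_def
      times_quat_def scaleR_quat_def)

lemma norm_quat_eq: "norm q = norm (qfst q, qsnd q)"
  by (simp add: norm_quat_def norm_Pair)

lemma norm_quat_sq: "complex_of_real ((norm q)\<^sup>2) = qfst q * cnj (qfst q) + qsnd q * cnj (qsnd q)"
  by (simp add: norm_quat_def complex_norm_square [symmetric] del: of_real_power)

lemma norm_quat_zero_iff: "norm (q :: quat) = 0 \<longleftrightarrow> q = 0"
  by (simp add: norm_quat_eq quat_eq_iff zero_prod_def)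

lemma quat_inverse_left: "inverse q * q = 1" if "q \<noteq> (0 :: quat)"
proof -
  define N where "N = complex_of_real ((norm q)\<^sup>2)"
  have N: "N \<noteq> 0" "cnj N = N" "qfst q * cnj (qfst q) + qsnd q * cnj (qsnd q) = N"
    using that norm_quat_zero_iff by (simp_all add: N_def norm_quat_sq [symmetric] del: of_real_power)
  have "inverse q = Quat (cnj (qfst q) / N) (- qsnd q / N)"
    by (simp only: inverse_quat_def N_def)
  then show ?thesis
    using N by (simp add: quat_eq_iff algebra_simps flip: add_divide_distrib)
qed

lemma quat_inverse_right: "q * inverse q = 1" if "q \<noteq> (0 :: quat)"
proof -
  define N where "N = complex_of_real ((norm q)\<^sup>2)"
  have N: "N \<noteq> 0" "cnj N = N" "qfst q * cnj (qfst q) + qsnd q * cnj (qsnd q) = N"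
    using that norm_quat_zero_iff by (simp_all add: N_def norm_quat_sq [symmetric] del: of_real_power)
  have "inverse q = Quat (cnj (qfst q) / N) (- qsnd q / N)"
    by (simp only: inverse_quat_def N_def)
  then show ?thesis
    using N by (simp add: quat_eq_iff algebra_simps flip: add_divide_distrib)
qed

lemma norm_quat_mult: "norm (p * q) = norm p * norm (q :: quat)"
proof -
  have "complex_of_real ((norm (p * q))\<^sup>2) = complex_of_real ((norm p)\<^sup>2 * (norm q)\<^sup>2)"
    unfolding of_real_mult norm_quat_sq by (simp add: algebra_simps)
  then have "(norm (p * q))\<^sup>2 = (norm p * norm q)\<^sup>2"
    by (simp only: of_real_eq_iff power_mult_distrib)
  then show ?thesis
    by (rule power2_eq_imp_eq) (simp_all add: norm_quat_def)
qed

instance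
proof
  fix p q r :: quat and a b :: real and U :: "quat set"
  show "p * q * r = p * (q * r)" by (simp add: quat_eq_iff algebra_simps)
  show "q \<noteq> 0 \<Longrightarrow> inverse q * q = 1" by (rule quat_inverse_left)
  show "q \<noteq> 0 \<Longrightarrow> q * inverse q = 1" by (rule quat_inverse_right)
  show "norm (p * q) = norm p * norm q" by (rule norm_quat_mult)
  show "norm q = 0 \<longleftrightarrow> q = 0" by (rule norm_quat_zero_iff)
  show "norm (p + q) \<le> norm p + norm q"
    using norm_triangle_ineq [of "(qfst p, qsnd p)" "(qfst q, qsnd q)"] by (simp add: norm_quat_eq)
  show "norm (a *\<^sub>R q) = \<bar>a\<bar> * norm q"
    using norm_scaleR [of a "(qfst q, qsnd q)"] by (simp add: norm_quat_eq)
  show "inverse (0 :: quat) = 0" by (simp add: quat_eq_iff inverse_quat_def)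
qed (simp_all add: quat_eq_iff algebra_simps divide_quat_def sgn_quat_def dist_quat_def
      uniformity_quat_def open_quat_def)

end


section \<open>The quaternionic projective plane\<close>

definition rscale :: "quat^3 \<Rightarrow> quat \<Rightarrow> quat^3"  (infixl "\<odot>" 75) where
  "z \<odot> a = (\<chi> i. z $ i * a)"

definition proj_rel :: "quat^3 \<Rightarrow> quat^3 \<Rightarrow> bool" where
  "proj_rel z w \<longleftrightarrow> z \<noteq> 0 \<and> w \<noteq> 0 \<and> (\<exists>a. a \<noteq> 0 \<and> w = z \<odot> a)"

lemma rscale_rscale: "z \<odot> a \<odot> b = z \<odot> (a * b)"
  by (simp add: rscale_def vec_eq_iff mult.assoc)

lemma rscale_one [simp]: "z \<odot> 1 = z"
  by (simp add: rscale_def vec_eq_iff)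

lemma part_equivp_proj_rel: "part_equivp proj_rel"
proof (rule part_equivpI)
  show "\<exists>z. proj_rel z z"
    by (rule exI [of _ 1]) (auto simp: proj_rel_def intro: exI [of _ 1])
  show "symp proj_rel"
  proof (rule sympI)
    fix z w assume "proj_rel z w"
    then obtain a where "z \<noteq> 0" "w \<noteq> 0" "a \<noteq> 0" "w = z \<odot> a" by (auto simp: proj_rel_def)
    then have "z = w \<odot> inverse a" by (simp add: rscale_rscale)
    with \<open>z \<noteq> 0\<close> \<open>w \<noteq> 0\<close> \<open>a \<noteq> 0\<close> show "proj_rel w z"
      unfolding proj_rel_def by (metis nonzero_imp_inverse_nonzero)
  qed
  show "transp proj_rel"
  proof (rule transpI)
    fix z w v assume "proj_rel z w" "proj_rel w v"
    then show "proj_rel z v"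
      unfolding proj_rel_def by (metis rscale_rscale mult_eq_0_iff)
  qed
qed

quotient_type p2h = "quat^3" / partial: proj_rel
  by (rule part_equivp_proj_rel)

text \<open>The class \<^term>\<open>abs_p2h z\<close> is meaningful for nonzero \<open>z\<close> only. The plane carries the quotient
  topology of \<open>quat^3 - {0}\<close>, which is open in \<open>quat^3\<close>.\<close>

instantiation p2h :: topological_space
begin

definition open_p2h :: "p2h set \<Rightarrow> bool" where
  "open_p2h U \<longleftrightarrow> open {z. z \<noteq> 0 \<and> abs_p2h z \<in> U}"

instance
proof
  show "open (UNIV :: p2h set)"
    using open_Compl [of "{0 :: quat^3}"] by (simp add: open_p2h_def Compl_eq)
next
  fix S T :: "p2h set"
  assume "open S" "open T"
  then have "open ({z. z \<noteq> 0 \<and> abs_p2h z \<in> S} \<inter> {z. z \<noteq> 0 \<and> abs_p2h z \<in> T})"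
    unfolding open_p2h_def by (rule open_Int)
  moreover have "{z. z \<noteq> 0 \<and> abs_p2h z \<in> S} \<inter> {z. z \<noteq> 0 \<and> abs_p2h z \<in> T}
      = {z. z \<noteq> 0 \<and> abs_p2h z \<in> S \<inter> T}" by auto
  ultimately show "open (S \<inter> T)" by (simp add: open_p2h_def)
next
  fix K :: "p2h set set"
  assume "\<forall>S\<in>K. open S"
  then have "open (\<Union>S\<in>K. {z. z \<noteq> 0 \<and> abs_p2h z \<in> S})"
    by (auto simp: open_p2h_def)
  moreover have "(\<Union>S\<in>K. {z. z \<noteq> 0 \<and> abs_p2h z \<in> S}) = {z. z \<noteq> 0 \<and> abs_p2h z \<in> \<Union>K}" by auto
  ultimately show "open (\<Union>K)" by (simp add: open_p2h_def)
qed

end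

definition pt :: "quat \<Rightarrow> quat \<Rightarrow> quat \<Rightarrow> p2h" where
  "pt x y z = abs_p2h (vector [x, y, z])"

definition e1 :: p2h where "e1 = pt 1 0 0"
definition e2 :: p2h where "e2 = pt 0 1 0"
definition e3 :: p2h where "e3 = pt 0 0 1"

definition proj_line :: "p2h \<Rightarrow> p2h \<Rightarrow> p2h set" where
  "proj_line p q = {abs_p2h (u \<odot> a + v \<odot> b) | u v a b.
     u \<noteq> 0 \<and> v \<noteq> 0 \<and> abs_p2h u = p \<and> abs_p2h v = q \<and> u \<odot> a + v \<odot> b \<noteq> 0}"


section \<open>The groups \<open>SL(3,H)\<close> and \<open>PSL(3,H)\<close>\<close>

definition complex_mat :: "quat^3^3 \<Rightarrow> complex^(3 + 3)^(3 + 3)" where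
  "complex_mat A = (\<chi> r c. case (r, c) of
      (Inl i, Inl k) \<Rightarrow> qfst (A $ i $ k)
    | (Inl i, Inr k) \<Rightarrow> qsnd (A $ i $ k)
    | (Inr i, Inl k) \<Rightarrow> - cnj (qsnd (A $ i $ k))
    | (Inr i, Inr k) \<Rightarrow> cnj (qfst (A $ i $ k)))"

definition SL3H :: "(quat^3^3) monoid" where
  "SL3H = \<lparr>carrier = {A. det (complex_mat A) = 1}, mult = (**), one = mat 1\<rparr>"

definition PSL3H :: "(quat^3^3) set monoid" where
  "PSL3H = SL3H Mod {mat 1, - mat 1}"

text \<open>Elements of \<^const>\<open>PSL3H\<close> are the cosets \<open>{A, - A}\<close>.\<close>

definition is_lift :: "quat^3^3 \<Rightarrow> (quat^3^3) set \<Rightarrow> bool" where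
  "is_lift g h \<longleftrightarrow> g \<in> carrier SL3H \<and> h = {mat 1, - mat 1} #>\<^bsub>SL3H\<^esub> g"

definition sl_act :: "quat^3^3 \<Rightarrow> p2h \<Rightarrow> p2h" where
  "sl_act A p = abs_p2h (A *v rep_p2h p)"

text \<open>Independent of the chosen lift, since \<open>A\<close> and \<open>- A\<close> act in the same way.\<close>

definition psl_act :: "(quat^3^3) set \<Rightarrow> p2h \<Rightarrow> p2h" where
  "psl_act h = sl_act (SOME A. is_lift A h)"

text \<open>Eigenvalues are right eigenvalues; they come in similarity classes.\<close>

definition right_eigenvalue :: "quat^3^3 \<Rightarrow> quat \<Rightarrow> bool" where
  "right_eigenvalue A q \<longleftrightarrow> (\<exists>v. v \<noteq> 0 \<and> A *v v = v \<odot> q)"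

definition quat_similar :: "quat \<Rightarrow> quat \<Rightarrow> bool" where
  "quat_similar p q \<longleftrightarrow> (\<exists>u. u \<noteq> 0 \<and> q = u * p * inverse u)"

text \<open>Semisimple means diagonalizable over the quaternions.\<close>

definition semisimple_mat :: "quat^3^3 \<Rightarrow> bool" where
  "semisimple_mat A \<longleftrightarrow> (\<exists>(P :: quat^3^3) (D :: quat^3^3).
     invertible P \<and> (\<forall>i k. i \<noteq> k \<longrightarrow> D $ i $ k = 0) \<and> A ** P = P ** D)"

definition parabolic_mat :: "quat^3^3 \<Rightarrow> bool" where
  "parabolic_mat A \<longleftrightarrow> \<not> semisimple_mat A \<and>
     (\<forall>q. right_eigenvalue A q \<longrightarrow> (\<exists>c. cmod c = 1 \<and> quat_similar q (qc c)))"

text \<open>Passing from a lift \<open>A\<close> to \<open>- A\<close> negates the eigenvalues, so it does not matter which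
  lift is taken.\<close>

definition parabolic :: "(quat^3^3) set \<Rightarrow> bool" where
  "parabolic h \<longleftrightarrow> (\<exists>A. is_lift A h \<and> parabolic_mat A)"


section \<open>Kulkarni sets\<close>

definition cluster_points :: "'i set \<Rightarrow> ('i \<Rightarrow> 'x::topological_space set) \<Rightarrow> 'x set" where
  "cluster_points B A = {p. \<forall>U. open U \<and> p \<in> U \<longrightarrow> infinite {b \<in> B. U \<inter> A b \<noteq> {}}}"

definition kulkarni_L0 :: "'g set \<Rightarrow> ('g \<Rightarrow> 'x \<Rightarrow> 'x::topological_space) \<Rightarrow> 'x set" where
  "kulkarni_L0 G act = closure {x. infinite {g \<in> G. act g x = x}}"

definition kulkarni_L1 :: "'g set \<Rightarrow> ('g \<Rightarrow> 'x \<Rightarrow> 'x::topological_space) \<Rightarrow> 'x set" where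
  "kulkarni_L1 G act =
     closure (\<Union>x \<in> - kulkarni_L0 G act. cluster_points G (\<lambda>g. {act g x}))"

definition kulkarni_L2 :: "'g set \<Rightarrow> ('g \<Rightarrow> 'x \<Rightarrow> 'x::topological_space) \<Rightarrow> 'x set" where
  "kulkarni_L2 G act =
     closure (\<Union>K \<in> {K. compact K \<and> K \<subseteq> - (kulkarni_L0 G act \<union> kulkarni_L1 G act)}.
       cluster_points G (\<lambda>g. act g ` K))"

definition cyclic_group :: "(quat^3^3) set \<Rightarrow> (quat^3^3) set set" where
  "cyclic_group h = generate PSL3H {h}"

text \<open>For irrational \<open>\<alpha>\<close>, \<open>\<beta>\<close> with \<open>\<alpha> - \<beta>\<close> (resp. \<open>\<alpha> + \<beta>\<close>) rational, some power of the
  ellipto-parabolic map with eigenvalues \<open>rot \<alpha>\<close>, \<open>rot \<beta>\<close> fixes every point \<open>[w : 0 : 1]\<close> with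
  \<open>w\<close> in \<open>C\<close> (resp. in \<open>C j\<close>), so \<open>L0\<close> is then strictly larger than \<open>{e1, e3}\<close>. This is why
  the theorem asserts \<open>L0 = {e1, e3}\<close> only when neither \<open>\<alpha> + \<beta>\<close> nor \<open>\<alpha> - \<beta>\<close> is rational.\<close>

definition rot :: "real \<Rightarrow> quat" where
  "rot \<alpha> = qc (exp (2 * of_real pi * \<i> * of_real \<alpha>))"

end

theory Submission
  imports Defs
begin

text \<open>
  All four cases are instances of two families of upper triangular matrices whose powers have a
  closed form for every integer exponent \<open>n\<close>. Put \<open>l = rot \<alpha>\<close> and \<open>m = rot \<beta>\<close>. In the first family
  the \<open>n\<close>-th power sends \<open>[x : y : z]\<close> to
  \<open>[l^n x + n l^(n-1) y : l^n y : m^n z]\<close>; it contains the vertical translation (\<open>\<alpha> = \<beta> = 0\<close>) and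
  the ellipto-parabolic maps. In the second family it sends \<open>[x : y : z]\<close> to
  \<open>[l^n x + n l^(n-1) y + n(n-1)/2 l^(n-2) z : l^n y + n l^(n-1) z : l^n z]\<close>; it contains the
  non-vertical translation (\<open>\<alpha> = 0\<close>) and the ellipto-translations. The second entry of the first
  row of the \<open>n\<close>-th power is \<open>n l^(n-1)\<close>, so this power is \<open>\<plusminus>1\<close> only for \<open>n = 0\<close>. Hence distinct
  exponents give distinct elements of \<open>PSL(3,H)\<close>, and the Kulkarni sets can be computed for the
  resulting action of the integers.

  Everything then rests on comparing growth rates of homogeneous coordinates.

  \<^item> First family. Off the line \<open>y = 0\<close> no nonzero power has a fixed point, and the first
    coordinate grows like \<open>n\<close> while the others keep their norms, uniformly on compact sets; hence every cluster
    point there is \<open>e1\<close> (\<open>ep_power_cluster_points\<close>). On the line \<open>y = 0\<close> the map is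
    \<open>w \<mapsto> l w m^(-1)\<close> in the affine coordinate \<open>w = x z^(-1)\<close>. This is a pair of rotations, by
    \<open>\<alpha> - \<beta>\<close> and \<open>\<alpha> + \<beta>\<close> full turns, of the two complex coordinates of \<open>w\<close>. If \<open>\<alpha>\<close> and \<open>\<beta>\<close> are
    rational it has finite order and the line is \<open>L0\<close>. Otherwise at least one of \<open>\<alpha> - \<beta>\<close> and
    \<open>\<alpha> + \<beta>\<close> is irrational, so \<open>L0\<close> misses all \<open>w\<close> with both coordinates nonzero
    (\<open>generic_notin_L0\<close>); rotations are recurrent, so each such point is a
    cluster point of its own orbit (\<open>ep_power_recurrent\<close>), and these points are dense in the line,
    which makes the line \<open>L1\<close>. In all cases the union of \<open>L0\<close> and \<open>L1\<close> is the line \<open>y = 0\<close>, whence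
    \<open>L2 = {e1}\<close>.

  \<^item> Second family. A nonzero power fixes \<open>e1\<close> only, and along every other orbit the first
    coordinate outgrows the remaining ones, so \<open>L0 = L1 = {e1}\<close>. The images of a compact set \<open>K\<close>
    avoiding \<open>e1\<close> cannot accumulate at a point with \<open>z \<noteq> 0\<close>: powers with large exponents carry a
    neighbourhood of such a point uniformly towards \<open>e1\<close>, away from \<open>K\<close>
    (\<open>et_power_cluster_points_compact\<close>). Conversely the linear and the quadratic term can be
    played off against each other: along a sequence in a compact set with \<open>z\<close> of size about \<open>2/n\<close>
    they cancel, and the images converge to an arbitrary prescribed point of the line \<open>z = 0\<close>
    other than \<open>e1\<close> (\<open>et_power_witness\<close>), which is itself a cluster point of the orbit of \<open>e2\<close>.
    Hence that line is \<open>L2\<close>.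
\<close>

section \<open>Homogeneous coordinates and the topology of the plane\<close>

lemma rscale_nth [simp]: "(z \<odot> a) $ i = z $ i * a"
  by (simp add: rscale_def)

lemma rscale_eq_0_iff: "a \<noteq> 0 \<Longrightarrow> z \<odot> a = 0 \<longleftrightarrow> z = 0"
  by (auto simp: vec_eq_iff)

lemma proj_rel_refl: "v \<noteq> 0 \<Longrightarrow> proj_rel v v"
  unfolding proj_rel_def by (metis rscale_one zero_neq_one)

lemma abs_p2h_eq_iff:
  assumes "v \<noteq> 0" "w \<noteq> 0"
  shows "abs_p2h v = abs_p2h w \<longleftrightarrow> (\<exists>a. a \<noteq> 0 \<and> w = v \<odot> a)"
  using Quotient3_rel [OF Quotient3_p2h, of v w] assms proj_rel_refl
  by (auto simp: proj_rel_def)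

lemma rep_p2h_nonzero: "rep_p2h p \<noteq> 0"
  using Quotient3_rel_rep [OF Quotient3_p2h, of p p] by (simp add: proj_rel_def)

lemma abs_rep_p2h: "abs_p2h (rep_p2h p) = p"
  by (rule Quotient3_abs_rep [OF Quotient3_p2h])

definition nonzero :: "quat \<Rightarrow> quat \<Rightarrow> quat \<Rightarrow> bool" where
  "nonzero x y z \<longleftrightarrow> x \<noteq> 0 \<or> y \<noteq> 0 \<or> z \<noteq> 0"

lemma vec3_eq_iff: "v = w \<longleftrightarrow> v $ 1 = w $ 1 \<and> v $ 2 = w $ 2 \<and> v $ 3 = (w :: 'a^3) $ 3"
  by (simp add: vec_eq_iff forall_3)

lemma vector_coords: "vector [v $ 1, v $ 2, v $ 3] = (v :: 'a::zero^3)"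
  by (simp add: vec3_eq_iff)

lemma nonzero_vector_iff: "vector [x, y, z] \<noteq> (0 :: quat^3) \<longleftrightarrow> nonzero x y z"
  by (auto simp: vec3_eq_iff nonzero_def)

lemma nonzero_coords_iff: "nonzero (v $ 1) (v $ 2) (v $ 3) \<longleftrightarrow> (v :: quat^3) \<noteq> 0"
  by (auto simp: vec3_eq_iff nonzero_def)

lemma abs_p2h_eq_pt: "abs_p2h v = pt (v $ 1) (v $ 2) (v $ 3)"
  by (simp add: pt_def vector_coords)

lemma pt_eq_iff:
  assumes "nonzero x y z" "nonzero x' y' z'"
  shows "pt x y z = pt x' y' z' \<longleftrightarrow> (\<exists>a. a \<noteq> 0 \<and> x' = x * a \<and> y' = y * a \<and> z' = z * a)"
  using abs_p2h_eq_iff [of "vector [x, y, z]" "vector [x', y', z']"] assms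
  unfolding nonzero_vector_iff by (simp add: pt_def vec3_eq_iff)

lemma pt_cases:
  obtains x y z where "nonzero x y z" "p = pt x y z"
  using rep_p2h_nonzero [of p] abs_rep_p2h [of p]
  by (metis abs_p2h_eq_pt nonzero_coords_iff)

lemma pt_normalize:
  "x \<noteq> 0 \<Longrightarrow> pt x y z = pt 1 (y * inverse x) (z * inverse x)"
  "y \<noteq> 0 \<Longrightarrow> pt x y z = pt (x * inverse y) 1 (z * inverse y)"
  "z \<noteq> 0 \<Longrightarrow> pt x y z = pt (x * inverse z) (y * inverse z) 1"
proof -
  show "pt x y z = pt 1 (y * inverse x) (z * inverse x)" if "x \<noteq> 0"
    by (subst pt_eq_iff) (use that in \<open>auto simp: nonzero_def intro: exI [of _ "inverse x"]\<close>)
  show "pt x y z = pt (x * inverse y) 1 (z * inverse y)" if "y \<noteq> 0"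
    by (subst pt_eq_iff) (use that in \<open>auto simp: nonzero_def intro: exI [of _ "inverse y"]\<close>)
  show "pt x y z = pt (x * inverse z) (y * inverse z) 1" if "z \<noteq> 0"
    by (subst pt_eq_iff) (use that in \<open>auto simp: nonzero_def intro: exI [of _ "inverse z"]\<close>)
qed

text \<open>Subsets of the plane are described by conditions on homogeneous coordinates that are
  invariant under scaling from the right; openness and closedness can then be read off from the
  condition on the vector space upstairs.\<close>

definition homogeneous :: "(quat \<Rightarrow> quat \<Rightarrow> quat \<Rightarrow> bool) \<Rightarrow> bool" where
  "homogeneous \<Phi> \<longleftrightarrow> (\<forall>x y z a. a \<noteq> 0 \<longrightarrow> \<Phi> x y z \<longrightarrow> \<Phi> (x * a) (y * a) (z * a))"

lemma homogeneousI:
  "(\<And>x y z a. a \<noteq> 0 \<Longrightarrow> \<Phi> x y z \<Longrightarrow> \<Phi> (x * a) (y * a) (z * a)) \<Longrightarrow> homogeneous \<Phi>"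
  by (simp add: homogeneous_def)

definition locus :: "(quat \<Rightarrow> quat \<Rightarrow> quat \<Rightarrow> bool) \<Rightarrow> p2h set" where
  "locus \<Phi> = {pt x y z | x y z. nonzero x y z \<and> \<Phi> x y z}"

lemma locus_mono: "(\<And>x y z. \<Phi> x y z \<Longrightarrow> \<Psi> x y z) \<Longrightarrow> locus \<Phi> \<subseteq> locus \<Psi>"
  unfolding locus_def by blast

lemma pt_in_locus_iff:
  assumes "homogeneous \<Phi>" "nonzero x y z"
  shows "pt x y z \<in> locus \<Phi> \<longleftrightarrow> \<Phi> x y z"
proof
  assume "pt x y z \<in> locus \<Phi>"
  then obtain x' y' z' where *: "pt x' y' z' = pt x y z" "nonzero x' y' z'" "\<Phi> x' y' z'"
    unfolding locus_def mem_Collect_eq by metis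
  then obtain a where "a \<noteq> 0" "x = x' * a" "y = y' * a" "z = z' * a"
    using pt_eq_iff assms(2) by metis
  with * assms(1) show "\<Phi> x y z" unfolding homogeneous_def by blast
qed (use assms(2) in \<open>auto simp: locus_def\<close>)

lemma locus_preimage:
  assumes "homogeneous \<Phi>"
  shows "{v. v \<noteq> 0 \<and> abs_p2h v \<in> locus \<Phi>} = - {0} \<inter> {v. \<Phi> (v $ 1) (v $ 2) (v $ 3)}"
  using assms by (auto simp: abs_p2h_eq_pt pt_in_locus_iff nonzero_coords_iff)

lemma open_locus:
  assumes "homogeneous \<Phi>" "open {v :: quat^3. \<Phi> (v $ 1) (v $ 2) (v $ 3)}"
  shows "open (locus \<Phi>)"
  unfolding open_p2h_def locus_preimage [OF assms(1)]
  using assms(2) by (intro open_Int) auto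

lemma closed_locus:
  assumes "homogeneous \<Phi>" "closed {v :: quat^3. \<Phi> (v $ 1) (v $ 2) (v $ 3)}"
  shows "closed (locus \<Phi>)"
proof -
  have "{v. v \<noteq> 0 \<and> abs_p2h v \<in> - locus \<Phi>} = - {0} \<inter> - {v. \<Phi> (v $ 1) (v $ 2) (v $ 3)}"
    using locus_preimage [OF assms(1)] by blast
  then have "open (- locus \<Phi>)"
    unfolding open_p2h_def using assms(2) by (simp add: open_Int open_Compl)
  then show ?thesis by (simp add: closed_def)
qed

lemma open_nonzero: "open {v :: quat^3. v \<noteq> 0}"
  using open_Compl [of "{0 :: quat^3}"] by (simp add: Compl_eq)

lemma continuous_on_abs_p2h: "continuous_on {v. v \<noteq> 0} abs_p2h"
  unfolding continuous_on_open_vimage [OF open_nonzero]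
  by (auto simp: open_p2h_def vimage_def Int_def conj_commute)

lemma tendsto_pt:
  assumes "(f \<longlongrightarrow> x) F" "(g \<longlongrightarrow> y) F" "(h \<longlongrightarrow> z) F" "nonzero x y z"
  shows "((\<lambda>t. pt (f t) (g t) (h t)) \<longlongrightarrow> pt x y z) F"
proof -
  have "((\<lambda>t. vector [f t, g t, h t] :: quat^3) \<longlongrightarrow> vector [x, y, z]) F"
  proof (rule vec_tendstoI)
    fix i :: 3
    show "((\<lambda>t. (vector [f t, g t, h t] :: quat^3) $ i) \<longlongrightarrow> vector [x, y, z] $ i) F"
      using exhaust_3 [of i] assms(1-3) by auto
  qed
  moreover have "isCont abs_p2h (vector [x, y, z])"
    using continuous_on_abs_p2h assms(4) nonzero_vector_iff
    unfolding continuous_on_eq_continuous_at [OF open_nonzero] by blast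
  ultimately show ?thesis
    unfolding pt_def by (rule isCont_tendsto_compose [rotated])
qed

text \<open>The uniform estimates on a compact set all come from this: a condition that each point
  satisfies for some constant holds on the whole set for one constant.\<close>

lemma compact_exhaustion:
  fixes U :: "nat \<Rightarrow> 'a::topological_space set"
  assumes "compact K" "K \<subseteq> (\<Union>n. U n)" "\<And>n. open (U n)" "\<And>m n. m \<le> n \<Longrightarrow> U m \<subseteq> U n"
  obtains n where "K \<subseteq> U n"
proof -
  obtain C where C: "finite C" "K \<subseteq> (\<Union>n\<in>C. U n)"
    using compactE_image [OF assms(1), of UNIV U] assms(2,3) by auto
  \<comment> \<open>The index \<open>0\<close> is inserted because \<open>C\<close> may be empty.\<close>
  have "K \<subseteq> U (Max (insert 0 C))"
  proof
    fix x assume "x \<in> K"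
    then obtain n where "n \<in> C" "x \<in> U n" using C by auto
    moreover have "n \<le> Max (insert 0 C)" using C(1) \<open>n \<in> C\<close> by simp
    ultimately show "x \<in> U (Max (insert 0 C))" using assms(4) by blast
  qed
  then show thesis by (rule that)
qed

text \<open>The three families of open sets used to measure growth: as \<open>R\<close> grows they exhaust, in this order, the
  complement of \<open>e1\<close>, of the line \<open>y = 0\<close> and of the line \<open>z = 0\<close>.\<close>

lemma homogeneous_norm_less:
  "homogeneous (\<lambda>x y z. norm x < R * (norm y + norm z))"
  "homogeneous (\<lambda>x y z. norm x + norm z < R * norm y)"
  "homogeneous (\<lambda>x y z. norm x + norm y < R * norm z)"
  unfolding homogeneous_def norm_mult
  by (simp_all flip: distrib_right mult.assoc)

lemma pt_in_locus_norm_less_iff: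
  assumes "nonzero x y z"
  shows "pt x y z \<in> locus (\<lambda>x y z. norm x < R * (norm y + norm z))
           \<longleftrightarrow> norm x < R * (norm y + norm z)"
    and "pt x y z \<in> locus (\<lambda>x y z. norm x + norm z < R * norm y)
           \<longleftrightarrow> norm x + norm z < R * norm y"
    and "pt x y z \<in> locus (\<lambda>x y z. norm x + norm y < R * norm z)
           \<longleftrightarrow> norm x + norm y < R * norm z"
  using pt_in_locus_iff [OF homogeneous_norm_less(1) assms]
    pt_in_locus_iff [OF homogeneous_norm_less(2) assms]
    pt_in_locus_iff [OF homogeneous_norm_less(3) assms] by auto

lemma open_locus_norm_less:
  "open (locus (\<lambda>x y z. norm x < R * (norm y + norm z)))"
  "open (locus (\<lambda>x y z. norm x + norm z < R * norm y))"
  "open (locus (\<lambda>x y z. norm x + norm y < R * norm z))"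
  by (intro open_locus homogeneous_norm_less open_Collect_less continuous_intros)+

lemma ex_nat_mult_greater:
  assumes "0 < (b :: real)" obtains n :: nat where "a < real n * b"
  using assms reals_Archimedean3 that by blast

lemma homogeneous_linear:
  "homogeneous (\<lambda>x y z. y = 0)" "homogeneous (\<lambda>x y z. z = 0)"
  "homogeneous (\<lambda>x y z. y = 0 \<and> z = 0)" "homogeneous (\<lambda>x y z. x = 0 \<and> y = 0)"
  by (auto simp: homogeneous_def)

lemma pt_in_locus_linear_iff:
  assumes "nonzero x y z"
  shows "pt x y z \<in> locus (\<lambda>x y z. y = 0) \<longleftrightarrow> y = 0"
    and "pt x y z \<in> locus (\<lambda>x y z. z = 0) \<longleftrightarrow> z = 0"
  using pt_in_locus_iff [OF homogeneous_linear(1) assms]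
    pt_in_locus_iff [OF homogeneous_linear(2) assms] by auto

lemma closed_locus_linear:
  "closed (locus (\<lambda>x y z. y = 0))" "closed (locus (\<lambda>x y z. z = 0))"
  "closed (locus (\<lambda>x y z. y = 0 \<and> z = 0))" "closed (locus (\<lambda>x y z. x = 0 \<and> y = 0))"
  by (intro closed_locus homogeneous_linear closed_Collect_eq closed_Collect_conj continuous_intros)+

lemma nonzero_e: "nonzero 1 0 0" "nonzero 0 1 0" "nonzero 0 0 1"
  by (simp_all add: nonzero_def)

lemma pt_eq_e1_iff: "nonzero x y z \<Longrightarrow> pt x y z = e1 \<longleftrightarrow> y = 0 \<and> z = 0"
  unfolding e1_def
  by (subst eq_commute, subst pt_eq_iff) (auto simp: nonzero_def)

lemma pt_eq_e3_iff: "nonzero x y z \<Longrightarrow> pt x y z = e3 \<longleftrightarrow> x = 0 \<and> y = 0"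
  unfolding e3_def
  by (subst eq_commute, subst pt_eq_iff) (auto simp: nonzero_def)

lemma singleton_e1: "{e1} = locus (\<lambda>x y z. y = 0 \<and> z = 0)"
  and singleton_e3: "{e3} = locus (\<lambda>x y z. x = 0 \<and> y = 0)"
  unfolding locus_def using nonzero_e pt_eq_e1_iff pt_eq_e3_iff e1_def e3_def by (fastforce)+

lemma closed_e1: "closed {e1}" and closed_e3: "closed {e3}"
  by (simp_all add: singleton_e1 singleton_e3 closed_locus_linear)

text \<open>The line is defined through all pairs of representatives of its two points; one pair
  suffices, because a change of representative is absorbed by the scalars.\<close>

lemma proj_line_abs_p2h:
  fixes e f :: "quat^3"
  assumes "e \<noteq> 0" "f \<noteq> 0"
  shows "proj_line (abs_p2h e) (abs_p2h f) = {abs_p2h (e \<odot> a + f \<odot> b) | a b. e \<odot> a + f \<odot> b \<noteq> 0}"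
    (is "?L = ?R")
proof
  show "?L \<subseteq> ?R"
  proof
    fix p assume "p \<in> ?L"
    then obtain u v a b where p: "p = abs_p2h (u \<odot> a + v \<odot> b)" "u \<odot> a + v \<odot> b \<noteq> 0"
      "u \<noteq> 0" "v \<noteq> 0" "abs_p2h e = abs_p2h u" "abs_p2h f = abs_p2h v"
      unfolding proj_line_def by force
    obtain s t where "u = e \<odot> s" "v = f \<odot> t"
      using p abs_p2h_eq_iff assms by metis
    then show "p \<in> ?R" using p rscale_rscale by auto
  qed
  show "?R \<subseteq> ?L" unfolding proj_line_def using assms by blast
qed

lemma proj_line_e1_e3: "proj_line e1 e3 = locus (\<lambda>x y z. y = 0)"
  and proj_line_e1_e2: "proj_line e1 e2 = locus (\<lambda>x y z. z = 0)"
proof -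
  have nz: "vector [1,0,0] \<noteq> (0::quat^3)" "vector [0,1,0] \<noteq> (0::quat^3)" "vector [0,0,1] \<noteq> (0::quat^3)"
    by (simp_all add: nonzero_vector_iff nonzero_e)
  have *: "vector [1,0,0] \<odot> a + vector [0,0,1] \<odot> b = vector [a, 0, b]"
    "vector [1,0,0] \<odot> a + vector [0,1,0] \<odot> b = vector [a, b, 0]" for a b
    by (simp_all add: vec3_eq_iff)
  show "proj_line e1 e3 = locus (\<lambda>x y z. y = 0)"
    unfolding e1_def e3_def pt_def proj_line_abs_p2h [OF nz(1) nz(3)] * nonzero_vector_iff locus_def
    by blast
  show "proj_line e1 e2 = locus (\<lambda>x y z. z = 0)"
    unfolding e1_def e2_def pt_def proj_line_abs_p2h [OF nz(1) nz(2)] * nonzero_vector_iff locus_def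
    by blast
qed

lemma compact_bounded_off_e1:
  assumes "compact K" "e1 \<notin> K"
  obtains R where "0 \<le> R" "K \<subseteq> locus (\<lambda>x y z. norm x < R * (norm y + norm z))"
proof -
  define U where "U = (\<lambda>n::nat. locus (\<lambda>x y z. norm x < real n * (norm y + norm z)))"
  have "K \<subseteq> (\<Union>n. U n)"
  proof
    fix p assume "p \<in> K"
    obtain x y z where p: "nonzero x y z" "p = pt x y z" by (rule pt_cases)
    with \<open>p \<in> K\<close> assms(2) have "0 < norm y + norm z"
      by (metis pt_eq_e1_iff add_nonneg_pos add_pos_nonneg norm_ge_zero zero_less_norm_iff)
    then obtain n :: nat where "norm x < real n * (norm y + norm z)" by (rule ex_nat_mult_greater)
    with p have "p \<in> U n" by (simp add: U_def pt_in_locus_norm_less_iff)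
    then show "p \<in> (\<Union>n. U n)" by blast
  qed
  moreover have "U m \<subseteq> U n" if "m \<le> n" for m n
  proof -
    have "real m * (norm y + norm z) \<le> real n * (norm y + norm z)" for y z :: quat
      using that by (intro mult_right_mono) auto
    then show ?thesis
      unfolding U_def by (intro locus_mono) (rule less_le_trans)
  qed
  moreover have "open (U n)" for n
    by (simp add: U_def open_locus_norm_less)
  ultimately obtain n where "K \<subseteq> U n" using compact_exhaustion [OF assms(1)] by metis
  then show thesis using that [of "real n"] by (simp add: U_def)
qed

lemma compact_bounded_off_line:
  assumes "compact K" "K \<inter> locus (\<lambda>x y z. y = 0) = {}"
  obtains R where "0 \<le> R" "K \<subseteq> locus (\<lambda>x y z. norm x + norm z < R * norm y)"
proof -
  define U where "U = (\<lambda>n::nat. locus (\<lambda>x y z. norm x + norm z < real n * norm y))"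
  have "K \<subseteq> (\<Union>n. U n)"
  proof
    fix p assume "p \<in> K"
    obtain x y z where p: "nonzero x y z" "p = pt x y z" by (rule pt_cases)
    with \<open>p \<in> K\<close> assms(2) have "y \<noteq> 0" using pt_in_locus_linear_iff(1) by blast
    then have "0 < norm y" by simp
    then obtain n :: nat where "norm x + norm z < real n * norm y" by (rule ex_nat_mult_greater)
    with p have "p \<in> U n" by (simp add: U_def pt_in_locus_norm_less_iff)
    then show "p \<in> (\<Union>n. U n)" by blast
  qed
  moreover have "U m \<subseteq> U n" if "m \<le> n" for m n
  proof -
    have "real m * norm y \<le> real n * norm y" for y :: quat
      using that by (intro mult_right_mono) auto
    then show ?thesis
      unfolding U_def by (intro locus_mono) (rule less_le_trans)
  qed
  moreover have "open (U n)" for n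
    by (simp add: U_def open_locus_norm_less)
  ultimately obtain n where "K \<subseteq> U n" using compact_exhaustion [OF assms(1)] by metis
  then show thesis using that [of "real n"] by (simp add: U_def)
qed


section \<open>Cyclic groups in \<open>PSL(3,H)\<close>\<close>

lemma sum_UNIV_sum:
  fixes f :: "'a::finite + 'b::finite \<Rightarrow> 'c::comm_monoid_add"
  shows "(\<Sum>x\<in>UNIV. f x) = (\<Sum>i\<in>UNIV. f (Inl i)) + (\<Sum>i\<in>UNIV. f (Inr i))"
  by (simp add: sum.Plus comp_def flip: UNIV_Plus_UNIV)

text \<open>Multiplicativity transports the determinant condition from a lift to all of its powers.\<close>

lemma complex_mat_mult: "complex_mat (A ** B) = complex_mat A ** complex_mat B"
proof -
  have "complex_mat (A ** B) $ r $ c = (complex_mat A ** complex_mat B) $ r $ c" for r c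
    by (cases r; cases c)
      (simp_all add: complex_mat_def matrix_matrix_mult_def sum_UNIV_sum sum_3 algebra_simps)
  then show ?thesis by (simp add: vec_eq_iff)
qed

lemma complex_mat_1: "complex_mat (mat 1) = mat 1"
proof -
  have "complex_mat (mat 1) $ r $ c = mat 1 $ r $ c" for r c
    by (cases r; cases c) (simp_all add: complex_mat_def mat_def)
  then show ?thesis by (simp add: vec_eq_iff)
qed

lemma matrix_mult_uminus_left: "- A ** B = - (A ** (B :: 'a::ring_1^'n^'m))"
  by (simp add: vec_eq_iff matrix_matrix_mult_def sum_negf)

lemma SL3H_coset: "{mat 1, - mat 1} #>\<^bsub>SL3H\<^esub> A = {A, - A}"
  by (auto simp: r_coset_def SL3H_def matrix_mult_uminus_left)

lemma PSL3H_mult: "{A, - A} \<otimes>\<^bsub>PSL3H\<^esub> {B, - B} = {A ** B, - (A ** B)}"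
proof -
  have "- A ** B = - (A ** B)" "A ** - B = - (A ** B)" "- A ** - B = A ** B"
    by (simp_all add: vec_eq_iff matrix_matrix_mult_def sum_negf)
  then show ?thesis by (auto simp: PSL3H_def FactGroup_def set_mult_def SL3H_def)
qed

lemma PSL3H_one: "\<one>\<^bsub>PSL3H\<^esub> = {mat 1, - mat 1}"
  by (simp add: PSL3H_def FactGroup_def)

lemma PSL3H_carrier: "carrier PSL3H = {{A, - A} | A. A \<in> carrier SL3H}"
  by (auto simp: PSL3H_def FactGroup_def RCOSETS_def SL3H_coset)

lemma is_lift_iff: "is_lift A h \<longleftrightarrow> A \<in> carrier SL3H \<and> h = {A, - A}"
  by (simp add: is_lift_def SL3H_coset)

lemma sl_act_uminus: "sl_act (- A) = sl_act A"
proof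
  fix p
  define w where "w = A *v rep_p2h p"
  have "(- A) *v rep_p2h p = w \<odot> (- 1)"
    by (simp add: w_def vec_eq_iff matrix_vector_mult_def sum_negf)
  moreover have "abs_p2h (w \<odot> (- 1)) = abs_p2h w"
  proof (cases "w = 0")
    case False
    then have "w \<odot> (- 1) \<noteq> 0" by (simp add: rscale_eq_0_iff)
    with False show ?thesis
      using abs_p2h_eq_iff [of w "w \<odot> (- 1)"] by (metis neg_equal_0_iff_equal zero_neq_one)
  next
    case True
    then have "w \<odot> (- 1) = w" by (simp add: vec_eq_iff)
    then show ?thesis by simp
  qed
  ultimately show "sl_act (- A) p = sl_act A p" by (simp add: sl_act_def w_def)
qed

lemma psl_act_coset:
  assumes "A \<in> carrier SL3H" shows "psl_act {A, - A} = sl_act A"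
proof -
  define B where "B = (SOME B. is_lift B {A, - A})"
  have "is_lift B {A, - A}"
    unfolding B_def by (rule someI [of _ A]) (simp add: is_lift_iff assms)
  then have "B = A \<or> B = - A"
    by (auto simp: is_lift_iff doubleton_eq_iff)
  then show ?thesis using sl_act_uminus by (auto simp: psl_act_def B_def)
qed

text \<open>Left and right multiplication commute, so the choice of representative made in the definition
  of the action is immaterial; invertibility keeps the image vector away from zero.\<close>

lemma sl_act_abs_p2h:
  assumes "B ** A = mat 1" "v \<noteq> 0"
  shows "sl_act A (abs_p2h v) = abs_p2h (A *v v)"
proof -
  let ?w = "rep_p2h (abs_p2h v)"
  have inj: "A *v u \<noteq> 0" if "u \<noteq> 0" for u
  proof
    assume "A *v u = 0"
    then have "B *v (A *v u) = 0" by (simp add: matrix_vector_mult_def vec_eq_iff)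
    with assms(1) that show False by (simp add: matrix_vector_mul_assoc)
  qed
  obtain a where a: "a \<noteq> 0" "?w = v \<odot> a"
    using abs_p2h_eq_iff [of v ?w] assms(2) rep_p2h_nonzero abs_rep_p2h by metis
  have "A *v ?w = (A *v v) \<odot> a"
    unfolding a(2) by (simp add: vec_eq_iff matrix_vector_mult_def sum_distrib_right mult.assoc)
  then show ?thesis
    using abs_p2h_eq_iff [of "A *v v" "A *v ?w"] inj assms(2) rep_p2h_nonzero a(1)
    by (metis sl_act_def)
qed

text \<open>Explicit formulas for all integer powers of a matrix are presented as a homomorphism from
  the additive group of integers.\<close>

definition one_parameter :: "(int \<Rightarrow> quat^3^3) \<Rightarrow> bool" where
  "one_parameter P \<longleftrightarrow> P 0 = mat 1 \<and> (\<forall>m n. P (m + n) = P m ** P n)"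

text \<open>The determinants form a homomorphism from the integers that is \<open>1\<close> at the generator.\<close>

lemma one_parameter_in_SL3H:
  assumes "one_parameter P" "P 1 \<in> carrier SL3H"
  shows "P n \<in> carrier SL3H"
proof -
  define d where "d = (\<lambda>n. det (complex_mat (P n)))"
  have d: "d (m + n) = d m * d n" "d 0 = 1" for m n
    using assms(1) by (simp_all add: d_def one_parameter_def complex_mat_mult complex_mat_1 det_mul)
  have d1: "d 1 = 1" using assms(2) by (simp add: SL3H_def d_def)
  have "d (- 1) = 1" using d(1) [of "- 1" 1] d(2) d1 by simp
  then have "d n = 1"
    using d(1) [of _ 1] d(1) [of _ "- 1"] d1 d(2) by (induction n rule: int_induct [of _ 0]) auto
  then show ?thesis by (simp add: SL3H_def d_def)
qed

text \<open>The inverse in a structure is a definite description; uniqueness is checked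
  directly on the two-element cosets.\<close>

lemma PSL3H_inv:
  assumes "A \<in> carrier SL3H" "B \<in> carrier SL3H" "A ** B = mat 1" "B ** A = mat 1"
  shows "inv\<^bsub>PSL3H\<^esub> {A, - A} = {B, - B}"
  unfolding m_inv_def
proof (rule the_equality)
  show "{B, - B} \<in> carrier PSL3H \<and> {A, - A} \<otimes>\<^bsub>PSL3H\<^esub> {B, - B} = \<one>\<^bsub>PSL3H\<^esub> \<and>
        {B, - B} \<otimes>\<^bsub>PSL3H\<^esub> {A, - A} = \<one>\<^bsub>PSL3H\<^esub>"
    using assms by (auto simp: PSL3H_mult PSL3H_one PSL3H_carrier)
next
  fix y
  assume y: "y \<in> carrier PSL3H \<and> {A, - A} \<otimes>\<^bsub>PSL3H\<^esub> y = \<one>\<^bsub>PSL3H\<^esub> \<and> y \<otimes>\<^bsub>PSL3H\<^esub> {A, - A} = \<one>\<^bsub>PSL3H\<^esub>"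
  then obtain C where C: "y = {C, - C}" by (auto simp: PSL3H_carrier)
  with y have "C ** A = mat 1 \<or> C ** A = - mat 1"
    by (auto simp: PSL3H_mult PSL3H_one doubleton_eq_iff)
  moreover have "C = (C ** A) ** B"
    by (metis assms(3) matrix_mul_assoc matrix_mul_rid)
  moreover have "- mat 1 ** B = - B"
    by (simp add: matrix_mult_uminus_left)
  ultimately have "C = B \<or> C = - B" by (metis matrix_mul_lid)
  then show "y = {B, - B}" using C by auto
qed

lemma cyclic_group_one_parameter:
  assumes P: "one_parameter P" and lift: "is_lift (P 1) h"
  shows "cyclic_group h = range (\<lambda>n. {P n, - P n})"
proof
  let ?C = "\<lambda>n. {P n, - P n}"
  have h: "h = ?C 1" and SL: "P n \<in> carrier SL3H" for n
    using lift one_parameter_in_SL3H [OF P] by (auto simp: is_lift_iff)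
  have add: "P (m + n) = P m ** P n" and zero: "P 0 = mat 1" for m n
    using P by (auto simp: one_parameter_def)
  have inv: "inv\<^bsub>PSL3H\<^esub> h = ?C (- 1)"
    unfolding h by (intro PSL3H_inv SL) (simp_all flip: add zero)
  have mult: "?C m \<otimes>\<^bsub>PSL3H\<^esub> ?C n = ?C (m + n)" for m n
    by (simp add: PSL3H_mult add)
  have one: "?C 0 = \<one>\<^bsub>PSL3H\<^esub>" by (simp add: zero PSL3H_one)
  show "cyclic_group h \<subseteq> range ?C"
  proof
    fix x assume "x \<in> cyclic_group h"
    then have "x \<in> generate PSL3H {h}" by (simp add: cyclic_group_def)
    then show "x \<in> range ?C"
    proof induction
      case one then show ?case using \<open>?C 0 = \<one>\<^bsub>PSL3H\<^esub>\<close> by blast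
    next
      case (incl x) then show ?case using h by blast
    next
      case (inv x) then show ?case using \<open>inv\<^bsub>PSL3H\<^esub> h = ?C (- 1)\<close> by blast
    next
      case (eng x y) then show ?case using mult by blast
    qed
  qed
  have "?C n \<in> generate PSL3H {h}" for n
  proof (induction n rule: int_induct [of _ 0])
    case base show ?case unfolding one by (rule generate.one)
  next
    case (step1 i)
    have "?C i \<otimes>\<^bsub>PSL3H\<^esub> ?C 1 \<in> generate PSL3H {h}"
      by (rule generate.eng [OF step1(2)]) (rule generate.incl, simp add: h)
    then show ?case unfolding mult .
  next
    case (step2 i)
    have "?C i \<otimes>\<^bsub>PSL3H\<^esub> ?C (- 1) \<in> generate PSL3H {h}"
      unfolding inv [symmetric] by (rule generate.eng [OF step2(2)]) (rule generate.inv [OF singletonI])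
    then show ?case unfolding mult by simp
  qed
  then show "range ?C \<subseteq> cyclic_group h" by (auto simp: cyclic_group_def)
qed

text \<open>The Kulkarni sets only count group elements, so an injective parametrization of the group may
  replace the group.\<close>

lemma kulkarni_reindex:
  fixes act :: "'g \<Rightarrow> 'x \<Rightarrow> 'x::topological_space"
  assumes "inj \<phi>" and act: "\<And>n. act (\<phi> n) = act' n"
  shows "kulkarni_L0 (range \<phi>) act = kulkarni_L0 UNIV act'"
    and "kulkarni_L1 (range \<phi>) act = kulkarni_L1 UNIV act'"
    and "kulkarni_L2 (range \<phi>) act = kulkarni_L2 UNIV act'"
proof -
  have inf: "infinite {g \<in> range \<phi>. R (act g)} \<longleftrightarrow> infinite {n \<in> UNIV. R (act' n)}" for R
  proof -
    have "{g \<in> range \<phi>. R (act g)} = \<phi> ` {n \<in> UNIV. R (act' n)}" using act by auto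
    moreover have "inj_on \<phi> {n \<in> UNIV. R (act' n)}" by (rule inj_on_subset [OF assms(1) subset_UNIV])
    ultimately show ?thesis by (simp only: finite_image_iff)
  qed
  have clus: "cluster_points (range \<phi>) (\<lambda>g. F (act g)) = cluster_points UNIV (\<lambda>n. F (act' n))"
    for F :: "('x \<Rightarrow> 'x) \<Rightarrow> 'x set"
    unfolding cluster_points_def using inf [of "\<lambda>f. _ \<inter> F f \<noteq> {}"] by simp
  show L0: "kulkarni_L0 (range \<phi>) act = kulkarni_L0 UNIV act'"
    unfolding kulkarni_L0_def using inf [of "\<lambda>f. f _ = _"] by simp
  show L1: "kulkarni_L1 (range \<phi>) act = kulkarni_L1 UNIV act'"
    unfolding kulkarni_L1_def L0 using clus [of "\<lambda>f. {f _}"] by simp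
  show "kulkarni_L2 (range \<phi>) act = kulkarni_L2 UNIV act'"
    unfolding kulkarni_L2_def L0 L1 using clus [of "\<lambda>f. f ` _"] by simp
qed

text \<open>Injectivity of \<open>n \<mapsto> {P n, - P n}\<close> is the absence of a nonzero exponent with \<open>P n = \<plusminus>1\<close>.
  With it, the group of cosets is replaced by the integers acting through explicit matrices.\<close>

lemma kulkarni_one_parameter:
  assumes P: "one_parameter P" and lift: "is_lift (P 1) h"
    and inj: "\<And>n. P n = mat 1 \<or> P n = - mat 1 \<Longrightarrow> n = 0"
  shows "kulkarni_L0 (cyclic_group h) psl_act = kulkarni_L0 UNIV (\<lambda>n. sl_act (P n))"
    and "kulkarni_L1 (cyclic_group h) psl_act = kulkarni_L1 UNIV (\<lambda>n. sl_act (P n))"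
    and "kulkarni_L2 (cyclic_group h) psl_act = kulkarni_L2 UNIV (\<lambda>n. sl_act (P n))"
proof -
  have "inj (\<lambda>n. {P n, - P n})"
  proof (rule injI)
    fix m n assume "{P m, - P m} = {P n, - P n}"
    then have "P m = P n \<or> P m = - P n" by (auto simp: doubleton_eq_iff)
    moreover have "P (m - n) = P m ** P (- n)" "mat 1 = P n ** P (- n)"
      using P unfolding one_parameter_def by (metis diff_conv_add_uminus, metis add.right_inverse)
    ultimately have "P (m - n) = mat 1 \<or> P (m - n) = - mat 1"
      by (metis matrix_mult_uminus_left)
    then show "m = n" using inj [of "m - n"] by simp
  qed
  moreover have "psl_act {P n, - P n} = sl_act (P n)" for n
    using one_parameter_in_SL3H [OF P] lift by (intro psl_act_coset) (simp add: is_lift_iff)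
  ultimately show
    "kulkarni_L0 (cyclic_group h) psl_act = kulkarni_L0 UNIV (\<lambda>n. sl_act (P n))"
    "kulkarni_L1 (cyclic_group h) psl_act = kulkarni_L1 UNIV (\<lambda>n. sl_act (P n))"
    "kulkarni_L2 (cyclic_group h) psl_act = kulkarni_L2 UNIV (\<lambda>n. sl_act (P n))"
    unfolding cyclic_group_one_parameter [OF P lift] by (intro kulkarni_reindex; simp)+
qed

lemma one_parameter_act_pt:
  assumes "one_parameter P" "nonzero x y z"
  shows "sl_act (P n) (pt x y z) = abs_p2h (P n *v vector [x, y, z])"
proof -
  have "P (- n) ** P n = mat 1" using assms(1) unfolding one_parameter_def by (metis add.left_inverse)
  then show ?thesis unfolding pt_def using assms(2) nonzero_vector_iff by (intro sl_act_abs_p2h) auto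
qed

lemma one_parameter_act_inverse:
  assumes "one_parameter P"
  shows "sl_act (P (- n)) (sl_act (P n) p) = p"
proof -
  obtain x y z where p: "nonzero x y z" "p = pt x y z" by (rule pt_cases)
  let ?v = "vector [x, y, z] :: quat^3"
  have *: "P (- n) ** P n = mat 1" "P n ** P (- n) = mat 1"
    using assms unfolding one_parameter_def by (metis add.left_inverse, metis add.right_inverse)
  have v: "P (- n) *v (P n *v ?v) = ?v" by (simp add: matrix_vector_mul_assoc *)
  have "P n *v ?v \<noteq> 0"
  proof
    assume "P n *v ?v = 0"
    with v have "?v = 0" by (simp add: matrix_vector_mult_def vec_eq_iff)
    with p(1) nonzero_vector_iff show False by blast
  qed
  then show ?thesis
    using one_parameter_act_pt [OF assms p(1)] sl_act_abs_p2h [OF *(2)] v p(2) by (metis pt_def)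
qed


section \<open>Quaternionic rotations\<close>

lemma rot_eq_cis: "rot a = Quat (cis (2 * pi * a)) 0"
  by (simp add: rot_def qc_def cis_conv_exp mult_ac)

lemma qfst_rot: "qfst (rot a) = cis (2 * pi * a)" and qsnd_rot: "qsnd (rot a) = 0"
  by (simp_all add: rot_eq_cis)

lemma rot_mult: "rot a * rot b = rot (a + b)"
  by (simp add: quat_eq_iff qfst_rot qsnd_rot cis_mult distrib_left)

lemma rot_0: "rot 0 = 1"
  by (simp add: quat_eq_iff qfst_rot qsnd_rot)

lemma norm_rot: "norm (rot a) = 1"
  by (simp add: norm_quat_def qfst_rot qsnd_rot)

lemma rot_nonzero: "rot a \<noteq> 0"
  using norm_rot [of a] by auto

lemma rot_eq_1_iff: "rot a = 1 \<longleftrightarrow> a \<in> \<int>"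
proof -
  have "rot a = 1 \<longleftrightarrow> exp (\<i> * complex_of_real (2 * pi * a)) = 1"
    by (simp add: quat_eq_iff qfst_rot qsnd_rot cis_conv_exp)
  also have "\<dots> \<longleftrightarrow> (\<exists>n::int. 2 * pi * a = of_int (2 * n) * pi)"
    by (simp add: exp_eq_1)
  also have "\<dots> \<longleftrightarrow> (\<exists>n::int. a = of_int n)" by simp
  finally show ?thesis by (auto simp: Ints_def)
qed

lemma rot_mult_irrational_eq_1:
  assumes "rot (real_of_int n * a) = 1" "a \<notin> \<rat>"
  shows "n = 0"
proof (rule ccontr)
  assume "n \<noteq> 0"
  then have "a = (of_int n * a) / of_int n" by simp
  moreover have "of_int n * a \<in> \<rat>"
    using assms(1) Ints_subset_Rats by (auto simp: rot_eq_1_iff)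
  ultimately have "a \<in> \<rat>" by (metis Rats_divide Rats_of_int)
  with assms(2) show False by simp
qed

lemma rational_rot_period:
  assumes "a \<in> \<rat>" "b \<in> \<rat>"
  obtains N :: int where "N > 0" "\<And>k. rot (of_int (N * k) * a) = 1" "\<And>k. rot (of_int (N * k) * b) = 1"
proof -
  obtain p q :: int where a: "q > 0" "a = of_int p / of_int q" using Rats_cases' [OF assms(1)] by metis
  obtain r s :: int where b: "s > 0" "b = of_int r / of_int s" using Rats_cases' [OF assms(2)] by metis
  show thesis
  proof
    show "q * s > 0" using a b by simp
    fix k
    have "of_int (q * s * k) * a = real_of_int (s * k * p)" "of_int (q * s * k) * b = real_of_int (q * k * r)"
      using a b by simp_all
    then show "rot (of_int (q * s * k) * a) = 1" "rot (of_int (q * s * k) * b) = 1"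
      by (simp_all only: rot_eq_1_iff Ints_of_int)
  qed
qed

lemma bounded_linear_qfst: "bounded_linear qfst" and bounded_linear_qsnd: "bounded_linear qsnd"
proof -
  have "norm (qfst q) \<le> norm q" "norm (qsnd q) \<le> norm q" for q
    by (simp_all add: norm_quat_def)
  then show "bounded_linear qfst" "bounded_linear qsnd"
    by (intro bounded_linear_intro [where K = 1]; simp)+
qed

lemmas continuous_on_qfst [continuous_intros] = bounded_linear.continuous_on [OF bounded_linear_qfst]
lemmas continuous_on_qsnd [continuous_intros] = bounded_linear.continuous_on [OF bounded_linear_qsnd]

text \<open>As a normed space the quaternions are the Euclidean plane over the complex numbers.\<close>

lemma compact_cball_quat: "compact (cball (0 :: quat) r)"
proof -
  let ?f = "\<lambda>p. Quat (fst p) (snd p)"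
  have "bounded_linear ?f"
    by (rule bounded_linear_intro [where K = 1]) (simp_all add: quat_eq_iff norm_quat_eq)
  then have "compact (?f ` cball (0 :: complex \<times> complex) r)"
    by (intro compact_continuous_image compact_cball linear_continuous_on)
  moreover have "?f ` cball (0 :: complex \<times> complex) r = cball 0 r"
  proof
    show "?f ` cball (0 :: complex \<times> complex) r \<subseteq> cball 0 r"
      by (auto simp: norm_quat_eq)
    show "cball 0 r \<subseteq> ?f ` cball (0 :: complex \<times> complex) r"
    proof
      fix q :: quat assume "q \<in> cball 0 r"
      then have "(qfst q, qsnd q) \<in> cball 0 r" by (simp add: norm_quat_eq)
      moreover have "q = ?f (qfst q, qsnd q)" by simp
      ultimately show "q \<in> ?f ` cball (0 :: complex \<times> complex) r" by (rule rev_image_eqI)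
    qed
  qed
  ultimately show ?thesis by simp
qed

text \<open>A pair of rotations is recurrent: the powers lie in a compact torus, so a subsequence
  \<open>s\<close> is Cauchy, and the exponents \<open>s k - s N\<close> for one large \<open>N\<close> and all \<open>k \<ge> N\<close> bring both
  rotations simultaneously close to the identity.\<close>

lemma rot_recurrent:
  assumes "0 < \<epsilon>"
  shows "infinite {n::int. norm (rot (of_int n * a) - 1) < \<epsilon> \<and> norm (rot (of_int n * b) - 1) < \<epsilon>}"
proof -
  define f where "f k = (cis (2 * pi * (real k * a)), cis (2 * pi * (real k * b)))" for k :: nat
  have "compact (sphere (0::complex) 1 \<times> sphere (0::complex) 1)"
    by (intro compact_Times compact_sphere)
  then have "seq_compact (sphere (0::complex) 1 \<times> sphere (0::complex) 1)"
    by (rule compact_imp_seq_compact)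
  moreover have "\<forall>k. f k \<in> sphere (0::complex) 1 \<times> sphere (0::complex) 1"
    by (simp add: f_def)
  ultimately obtain l s where s: "strict_mono s" "(f \<circ> s) \<longlonglongrightarrow> l"
    by (rule seq_compactE)
  then have "Cauchy (f \<circ> s)" by (intro LIMSEQ_imp_Cauchy)
  then obtain N where N: "\<And>m. m \<ge> N \<Longrightarrow> dist (f (s m)) (f (s N)) < \<epsilon>"
    using assms unfolding Cauchy_def comp_def by blast
  have rot_diff: "norm (rot (of_int (int j - int k) * c) - 1)
      = dist (cis (2 * pi * (real j * c))) (cis (2 * pi * (real k * c)))" for j k c
  proof -
    have "rot (real j * c) - rot (real k * c) = (rot (of_int (int j - int k) * c) - 1) * rot (real k * c)"
      by (simp add: left_diff_distrib rot_mult)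
    then have "norm (rot (of_int (int j - int k) * c) - 1) = norm (rot (real j * c) - rot (real k * c))"
      by (simp only: norm_mult norm_rot mult_1_right)
    also have "\<dots> = dist (cis (2 * pi * (real j * c))) (cis (2 * pi * (real k * c)))"
      by (simp add: norm_quat_def qfst_rot qsnd_rot dist_norm)
    finally show ?thesis .
  qed
  have "(\<lambda>m. int (s m) - int (s N)) ` {N..} \<subseteq>
      {n::int. norm (rot (of_int n * a) - 1) < \<epsilon> \<and> norm (rot (of_int n * b) - 1) < \<epsilon>}"
  proof clarify
    fix m assume "N \<le> m"
    then have "dist (f (s m)) (f (s N)) < \<epsilon>" by (rule N)
    then show "norm (rot (of_int (int (s m) - int (s N)) * a) - 1) < \<epsilon> \<and>
        norm (rot (of_int (int (s m) - int (s N)) * b) - 1) < \<epsilon>"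
      unfolding rot_diff using dist_fst_le [of "f (s m)" "f (s N)"] dist_snd_le [of "f (s m)" "f (s N)"]
      by (simp add: f_def)
  qed
  moreover have "inj_on (\<lambda>m. int (s m) - int (s N)) {N..}"
    using strict_mono_imp_inj_on [OF s(1)] by (auto simp: inj_on_def)
  then have "infinite ((\<lambda>m. int (s m) - int (s N)) ` {N..})"
    by (simp add: finite_image_iff infinite_Ici)
  ultimately show ?thesis using finite_subset by blast
qed

text \<open>The commutator of a complex number \<open>c\<close> with any quaternion lies in \<open>C j\<close>, hence can never
  equal a nonzero complex number. This is what excludes periodic points off the fixed line.\<close>

lemma rot_translation_fixed:
  assumes "rot a * x + r *\<^sub>R rot b = x * rot a"
  shows "r = 0"
proof -
  have "qfst (rot a * x + r *\<^sub>R rot b) = qfst (x * rot a)" by (simp only: assms)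
  then show ?thesis by (simp add: qfst_rot qsnd_rot)
qed

text \<open>Writing \<open>w = u + v j\<close>, conjugation by \<open>j\<close> turns \<open>rot b\<close> into \<open>rot (- b)\<close>. The map
  \<open>w \<mapsto> rot a * w * rot (- b)\<close> therefore rotates \<open>u\<close> by \<open>a - b\<close> and \<open>v\<close> by \<open>a + b\<close>.\<close>

lemma rot_intertwines:
  assumes "rot a * w = w * rot b"
  shows "qfst w = 0 \<or> rot (a - b) = 1" "qsnd w = 0 \<or> rot (a + b) = 1"
proof -
  have "qfst (rot a * w) = qfst (w * rot b)" "qsnd (rot a * w) = qsnd (w * rot b)"
    by (simp_all only: assms)
  then have *: "qfst w = 0 \<or> cis (2 * pi * a) = cis (2 * pi * b)"
    "qsnd w = 0 \<or> cis (2 * pi * a) = cis (- (2 * pi * b))"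
    by (simp_all add: qfst_rot qsnd_rot cis_cnj)
  have 1: "rot (a - b) = 1" if "cis (2 * pi * a) = cis (2 * pi * b)"
  proof -
    have "rot (a - b) = rot a * rot (- b)" by (simp add: rot_mult)
    also have "rot a = rot b" using that by (simp add: rot_eq_cis)
    finally show ?thesis by (simp add: rot_mult rot_0)
  qed
  have 2: "rot (a + b) = 1" if "cis (2 * pi * a) = cis (- (2 * pi * b))"
  proof -
    have "rot (a + b) = rot a * rot b" by (simp add: rot_mult)
    also have "rot a = rot (- b)" using that by (simp add: rot_eq_cis)
    finally show ?thesis by (simp add: rot_mult rot_0)
  qed
  show "qfst w = 0 \<or> rot (a - b) = 1" "qsnd w = 0 \<or> rot (a + b) = 1" using * 1 2 by blast+
qed

section \<open>Cluster points\<close>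

text \<open>The shift \<open>j\<close> allows a sequence to start where its formula makes sense.\<close>

lemma cluster_points_tendsto:
  assumes "(q \<longlongrightarrow> p) sequentially" "\<And>k::nat. q k \<in> A (int (k + j))"
  shows "p \<in> cluster_points UNIV A"
  unfolding cluster_points_def
proof (clarify)
  fix U assume U: "open U" "p \<in> U" and fin: "finite {n \<in> UNIV. U \<inter> A n \<noteq> {}}"
  from assms(1) U have "eventually (\<lambda>k. q k \<in> U) sequentially" by (rule topological_tendstoD)
  then obtain N where "\<And>k. k \<ge> N \<Longrightarrow> q k \<in> U" by (auto simp: eventually_sequentially)
  with assms(2) have "(\<lambda>k. int (k + j)) ` {N..} \<subseteq> {n \<in> UNIV. U \<inter> A n \<noteq> {}}" by blast
  then have "finite ((\<lambda>k. int (k + j)) ` {N..})" using fin finite_subset by blast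
  moreover have "inj_on (\<lambda>k. int (k + j)) {N..}" by (simp add: inj_on_def)
  ultimately show False by (simp add: finite_image_iff infinite_Ici)
qed

lemma cluster_points_subset_closed:
  assumes "closed C" "\<And>n. A n \<subseteq> C"
  shows "cluster_points I A \<subseteq> C"
proof
  fix p assume p: "p \<in> cluster_points I A"
  show "p \<in> C"
  proof (rule ccontr)
    assume "p \<notin> C"
    with assms(1) p have "infinite {n \<in> I. - C \<inter> A n \<noteq> {}}"
      unfolding cluster_points_def closed_def by blast
    moreover have "{n \<in> I. - C \<inter> A n \<noteq> {}} = {}" using assms(2) by blast
    ultimately show False by simp
  qed
qed

text \<open>Every point other than \<open>e1\<close> lies in the open set \<open>norm x < R * (norm y + norm z)\<close> for some
  \<open>R\<close>, so a family that eventually leaves each of these sets can only accumulate at \<open>e1\<close>.\<close>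

lemma cluster_points_subset_e1:
  assumes "\<And>R. 0 \<le> R \<Longrightarrow> finite {n. locus (\<lambda>x y z. norm x < R * (norm y + norm z)) \<inter> A n \<noteq> {}}"
  shows "cluster_points UNIV A \<subseteq> {e1}"
proof
  fix p assume p: "p \<in> cluster_points UNIV A"
  show "p \<in> {e1}"
  proof (rule ccontr)
    assume "p \<notin> {e1}"
    then obtain R where "0 \<le> R" "p \<in> locus (\<lambda>x y z. norm x < R * (norm y + norm z))"
      using compact_bounded_off_e1 [of "{p}"] by auto
    then show False using p assms open_locus_norm_less(1) [of R] unfolding cluster_points_def by force
  qed
qed

lemma finite_int_bounded: "finite {n::int. \<bar>real_of_int n\<bar> \<le> M}"
proof (rule finite_subset)
  show "{n::int. \<bar>real_of_int n\<bar> \<le> M} \<subseteq> {- \<lceil>M\<rceil>..\<lceil>M\<rceil>}" by (auto; linarith)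
qed simp

text \<open>This is the shape of the orbit of \<open>e2\<close> in both families: the first coordinate
  grows linearly and the second has norm \<open>1\<close>.\<close>

lemma e1_cluster_point:
  assumes "\<And>n. A n = {pt (of_int n *\<^sub>R rot (a n)) (rot (b n)) 0}"
  shows "e1 \<in> cluster_points UNIV A"
proof (rule cluster_points_tendsto [where j = 1])
  let ?y = "\<lambda>k. rot (b (int (k + 1))) * inverse (real (k + 1) *\<^sub>R rot (a (int (k + 1))))"
  have "norm (?y k) = inverse (real (Suc k))" for k
    by (simp add: norm_mult norm_inverse norm_rot)
  then have "(\<lambda>k. norm (?y k)) \<longlonglongrightarrow> 0" using LIMSEQ_inverse_real_of_nat by simp
  then have "?y \<longlonglongrightarrow> 0" by (rule tendsto_norm_zero_cancel)
  then show "(\<lambda>k. pt 1 (?y k) 0) \<longlonglongrightarrow> e1"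
    unfolding e1_def by (intro tendsto_pt tendsto_const) (simp_all add: nonzero_def)
  fix k
  have "real (k + 1) *\<^sub>R rot (a (int (k + 1))) \<noteq> 0" using rot_nonzero by simp
  then have "pt (real (k + 1) *\<^sub>R rot (a (int (k + 1)))) (rot (b (int (k + 1)))) 0 = pt 1 (?y k) 0"
    by (subst pt_normalize(1)) auto
  then show "pt 1 (?y k) 0 \<in> A (int (k + 1))" unfolding assms by simp
qed


section \<open>Ellipto-parabolic powers\<close>

definition ep_power :: "real \<Rightarrow> real \<Rightarrow> int \<Rightarrow> quat^3^3" where
  "ep_power \<alpha> \<beta> n = vector
    [vector [rot (of_int n * \<alpha>), of_int n *\<^sub>R rot (of_int (n - 1) * \<alpha>), 0],
     vector [0, rot (of_int n * \<alpha>), 0],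
     vector [0, 0, rot (of_int n * \<beta>)]]"

lemma ep_power_1:
  "ep_power \<alpha> \<beta> 1 = vector [vector [rot \<alpha>, 1, 0], vector [0, rot \<alpha>, 0], vector [0, 0, rot \<beta>]]"
  by (simp add: ep_power_def rot_0)

lemma one_parameter_ep_power: "one_parameter (ep_power \<alpha> \<beta>)"
  unfolding one_parameter_def
proof (intro conjI allI)
  show "ep_power \<alpha> \<beta> 0 = mat 1"
    by (simp add: vec3_eq_iff ep_power_def mat_def rot_0)
  fix m n
  have "of_int m * \<alpha> + of_int (n - 1) * \<alpha> = of_int (m + n - 1) * \<alpha>"
    "of_int (m - 1) * \<alpha> + of_int n * \<alpha> = of_int (m + n - 1) * \<alpha>"
    by (simp_all add: algebra_simps)
  then show "ep_power \<alpha> \<beta> (m + n) = ep_power \<alpha> \<beta> m ** ep_power \<alpha> \<beta> n"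
    by (simp add: vec3_eq_iff ep_power_def matrix_matrix_mult_def sum_3 rot_mult
        scaleR_add_left distrib_right del: of_int_diff)
qed

lemma ep_power_act:
  assumes "nonzero x y z"
  shows "sl_act (ep_power \<alpha> \<beta> n) (pt x y z)
    = pt (rot (of_int n * \<alpha>) * x + of_int n *\<^sub>R (rot (of_int (n - 1) * \<alpha>) * y))
         (rot (of_int n * \<alpha>) * y) (rot (of_int n * \<beta>) * z)"
  unfolding one_parameter_act_pt [OF one_parameter_ep_power assms] abs_p2h_eq_pt
  by (simp add: ep_power_def matrix_vector_mult_def sum_3)

lemma ep_power_act_nonzero:
  assumes "nonzero x y z"
  shows "nonzero (rot (of_int n * \<alpha>) * x + of_int n *\<^sub>R (rot (of_int (n - 1) * \<alpha>) * y))
         (rot (of_int n * \<alpha>) * y) (rot (of_int n * \<beta>) * z)"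
  using assms rot_nonzero by (auto simp: nonzero_def)

lemma ep_power_act_eq_iff:
  assumes "nonzero x y z"
  shows "sl_act (ep_power \<alpha> \<beta> n) (pt x y z) = pt x y z \<longleftrightarrow>
    (\<exists>a. a \<noteq> 0 \<and> rot (of_int n * \<alpha>) * x + of_int n *\<^sub>R (rot (of_int (n - 1) * \<alpha>) * y) = x * a \<and>
      rot (of_int n * \<alpha>) * y = y * a \<and> rot (of_int n * \<beta>) * z = z * a)"
  unfolding ep_power_act [OF assms] pt_eq_iff [OF assms ep_power_act_nonzero [OF assms], symmetric]
  by (rule eq_commute)

text \<open>If \<open>y \<noteq> 0\<close>, normalize to \<open>y = 1\<close>. The scalar relating both sides must then be \<open>l^n\<close>, and the
  first coordinates give a commutator equal to the nonzero complex number \<open>n l^(n-1)\<close> up to sign,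
  which is impossible.\<close>

lemma ep_power_fixed_point:
  assumes "nonzero x y z" "n \<noteq> 0" "sl_act (ep_power \<alpha> \<beta> n) (pt x y z) = pt x y z"
  shows "y = 0"
proof (rule ccontr)
  assume "y \<noteq> 0"
  define w where "w = x * inverse y"
  have p: "pt x y z = pt w 1 (z * inverse y)" unfolding w_def by (rule pt_normalize(2) [OF \<open>y \<noteq> 0\<close>])
  have nz: "nonzero w 1 (z * inverse y)" by (simp add: nonzero_def)
  from assms(3) obtain a where "rot (of_int n * \<alpha>) * w + of_int n *\<^sub>R rot (of_int (n - 1) * \<alpha>) = w * a"
    "rot (of_int n * \<alpha>) = a"
    unfolding p ep_power_act_eq_iff [OF nz] by auto
  then have "real_of_int n = 0" by (metis rot_translation_fixed)
  with assms(2) show False by simp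
qed

lemma ep_power_fixed_point_on_line:
  assumes "sl_act (ep_power \<alpha> \<beta> n) (pt w 0 1) = pt w 0 1"
  shows "rot (of_int n * \<alpha>) * w = w * rot (of_int n * \<beta>)"
proof -
  have nz: "nonzero w 0 1" by (simp add: nonzero_def)
  show ?thesis
    using assms unfolding ep_power_act_eq_iff [OF nz] by auto
qed

lemma ep_power_act_e2:
  "sl_act (ep_power \<alpha> \<beta> n) e2 = pt (of_int n *\<^sub>R rot (of_int (n - 1) * \<alpha>)) (rot (of_int n * \<alpha>)) 0"
  by (simp add: e2_def ep_power_act [OF nonzero_e(2)])

lemma e1_cluster_point_ep_power: "e1 \<in> cluster_points UNIV (\<lambda>n. {sl_act (ep_power \<alpha> \<beta> n) e2})"
  unfolding ep_power_act_e2 by (rule e1_cluster_point) simp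

lemma ep_power_act_fixed_e1_e3:
  "sl_act (ep_power \<alpha> \<beta> n) e1 = e1" "sl_act (ep_power \<alpha> \<beta> n) e3 = e3"
proof -
  have "sl_act (ep_power \<alpha> \<beta> n) (pt 1 0 0) = e1"
    unfolding ep_power_act [OF nonzero_e(1)] pt_eq_e1_iff [OF ep_power_act_nonzero [OF nonzero_e(1)]]
    by simp
  moreover have "sl_act (ep_power \<alpha> \<beta> n) (pt 0 0 1) = e3"
    unfolding ep_power_act [OF nonzero_e(3)] pt_eq_e3_iff [OF ep_power_act_nonzero [OF nonzero_e(3)]]
    by simp
  ultimately show "sl_act (ep_power \<alpha> \<beta> n) e1 = e1" "sl_act (ep_power \<alpha> \<beta> n) e3 = e3"
    by (simp_all add: e1_def e3_def)
qed

text \<open>If a point of \<open>K\<close> is moved by the \<open>n\<close>-th power into \<open>norm x < R' * (norm y + norm z)\<close>, then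
  \<open>\<bar>n\<bar> norm y\<close> is at most the norm of the new first coordinate plus the norm of the old one. Both
  are bounded by multiples of \<open>norm y\<close>, so only finitely many exponents qualify.\<close>

lemma ep_power_cluster_points:
  assumes "0 \<le> R" "K \<subseteq> locus (\<lambda>x y z. norm x + norm z < R * norm y)"
  shows "cluster_points UNIV (\<lambda>n. sl_act (ep_power \<alpha> \<beta> n) ` K) \<subseteq> {e1}"
proof (rule cluster_points_subset_e1)
  fix R' :: real assume "0 \<le> R'"
  let ?U = "locus (\<lambda>x y z. norm x < R' * (norm y + norm z))"
  have "\<bar>real_of_int n\<bar> \<le> R + R' * (1 + R)" if "?U \<inter> sl_act (ep_power \<alpha> \<beta> n) ` K \<noteq> {}" for n
  proof -
    from that obtain k where k: "k \<in> K" "sl_act (ep_power \<alpha> \<beta> n) k \<in> ?U" by blast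
    obtain x y z where p: "nonzero x y z" "k = pt x y z" by (rule pt_cases)
    have K: "norm x + norm z < R * norm y"
      using k(1) assms(2) p pt_in_locus_norm_less_iff(2) [OF p(1)] by blast
    define x' where "x' = rot (of_int n * \<alpha>) * x + of_int n *\<^sub>R (rot (of_int (n - 1) * \<alpha>) * y)"
    have "norm x' < R' * (norm y + norm z)"
      using k(2) unfolding p(2) ep_power_act [OF p(1)]
        pt_in_locus_norm_less_iff(1) [OF ep_power_act_nonzero [OF p(1)]]
      by (simp add: norm_mult norm_rot x'_def)
    also have "\<dots> \<le> R' * (norm y + R * norm y)"
      using K \<open>0 \<le> R'\<close> norm_ge_zero [of x] by (intro mult_left_mono) linarith+
    finally have x': "norm x' < R' * (norm y + R * norm y)" .
    have "norm (of_int n *\<^sub>R (rot (of_int (n - 1) * \<alpha>) * y)) \<le> norm x' + norm (rot (of_int n * \<alpha>) * x)"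
      unfolding x'_def by (metis add_diff_cancel_left' norm_triangle_ineq4)
    then have "\<bar>real_of_int n\<bar> * norm y \<le> norm x' + norm x"
      by (simp add: norm_mult norm_rot)
    also have "\<dots> \<le> (R + R' * (1 + R)) * norm y"
    proof -
      have "norm x' + norm x \<le> R' * (norm y + R * norm y) + R * norm y"
        using x' K norm_ge_zero [of z] by linarith
      then show ?thesis by (simp add: algebra_simps)
    qed
    finally have *: "\<bar>real_of_int n\<bar> * norm y \<le> (R + R' * (1 + R)) * norm y" .
    have "y \<noteq> 0"
    proof
      assume "y = 0"
      with K norm_ge_zero [of x] norm_ge_zero [of z] show False by simp
    qed
    with * show ?thesis by (simp add: mult_le_cancel_right)
  qed
  then show "finite {n. ?U \<inter> sl_act (ep_power \<alpha> \<beta> n) ` K \<noteq> {}}"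
    by (intro finite_subset [OF _ finite_int_bounded [of "R + R' * (1 + R)"]]) auto
qed

lemma ep_power_cluster_points_compact:
  assumes "compact K" "K \<inter> locus (\<lambda>x y z. y = 0) = {}"
  shows "cluster_points UNIV (\<lambda>n. sl_act (ep_power \<alpha> \<beta> n) ` K) \<subseteq> {e1}"
  using compact_bounded_off_line [OF assms] ep_power_cluster_points by metis

lemma ep_power_cluster_points_orbit:
  assumes "p \<notin> locus (\<lambda>x y z. y = 0)"
  shows "cluster_points UNIV (\<lambda>n. {sl_act (ep_power \<alpha> \<beta> n) p}) \<subseteq> {e1}"
  using ep_power_cluster_points_compact [of "{p}" \<alpha> \<beta>] assms by simp

lemma ep_power_L0_subset: "kulkarni_L0 UNIV (\<lambda>n. sl_act (ep_power \<alpha> \<beta> n)) \<subseteq> locus (\<lambda>x y z. y = 0)"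
  unfolding kulkarni_L0_def
proof (rule closure_minimal)
  show "{p. infinite {n \<in> UNIV. sl_act (ep_power \<alpha> \<beta> n) p = p}} \<subseteq> locus (\<lambda>x y z. y = 0)"
  proof clarify
    fix p assume inf: "infinite {n \<in> UNIV. sl_act (ep_power \<alpha> \<beta> n) p = p}"
    then obtain n where "n \<noteq> 0" "sl_act (ep_power \<alpha> \<beta> n) p = p"
      by (metis (mono_tags, lifting) finite.emptyI finite_insert finite_subset insert_iff mem_Collect_eq subsetI)
    then show "p \<in> locus (\<lambda>x y z. y = 0)"
      using ep_power_fixed_point pt_in_locus_linear_iff(1) by (metis pt_cases)
  qed
qed (rule closed_locus_linear)

lemma e2_notin_line: "e2 \<notin> locus (\<lambda>x y z. y = 0)"
  unfolding e2_def pt_in_locus_linear_iff [OF nonzero_e(2)] by simp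

text \<open>Compact sets off the line contract to \<open>e1\<close>, and \<open>e1\<close> is indeed a cluster point of the
  images of the compact set \<open>{e2}\<close>.\<close>

lemma ep_power_L2:
  fixes \<alpha> \<beta> :: real
  defines "act \<equiv> \<lambda>n. sl_act (ep_power \<alpha> \<beta> n)"
  assumes "kulkarni_L0 UNIV act \<union> kulkarni_L1 UNIV act = locus (\<lambda>x y z. y = 0)"
  shows "kulkarni_L2 UNIV act = {e1}"
proof
  show "kulkarni_L2 UNIV act \<subseteq> {e1}"
    unfolding kulkarni_L2_def assms(2)
  proof (rule closure_minimal [OF _ closed_e1], clarify)
    fix K p
    assume "p \<in> cluster_points UNIV (\<lambda>n. act n ` K)" "compact K" "K \<subseteq> - locus (\<lambda>x y z. y = 0)"
    then show "p = e1"
      using ep_power_cluster_points_compact [of K \<alpha> \<beta>] by (auto simp: act_def)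
  qed
  have "e1 \<in> cluster_points UNIV (\<lambda>n. act n ` {e2})"
    using e1_cluster_point_ep_power by (simp add: act_def)
  then have "e1 \<in> (\<Union>K \<in> {K. compact K \<and> K \<subseteq> - (kulkarni_L0 UNIV act \<union> kulkarni_L1 UNIV act)}.
       cluster_points UNIV (\<lambda>n. act n ` K))"
    using e2_notin_line unfolding assms(2) by (intro UN_I [of "{e2}"]) auto
  then have "e1 \<in> kulkarni_L2 UNIV act"
    unfolding kulkarni_L2_def by (rule closure_subset [THEN subsetD])
  then show "{e1} \<subseteq> kulkarni_L2 UNIV act" by simp
qed

lemma ep_power_rational:
  fixes \<alpha> \<beta> :: real
  defines "act \<equiv> \<lambda>n. sl_act (ep_power \<alpha> \<beta> n)"
  assumes "\<alpha> \<in> \<rat>" "\<beta> \<in> \<rat>"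
  shows "kulkarni_L0 UNIV act = locus (\<lambda>x y z. y = 0)"
    and "kulkarni_L1 UNIV act = {e1}"
    and "kulkarni_L2 UNIV act = {e1}"
proof -
  obtain N :: int where N: "N > 0" "\<And>k. rot (of_int (N * k) * \<alpha>) = 1" "\<And>k. rot (of_int (N * k) * \<beta>) = 1"
    using rational_rot_period [OF assms(2,3)] by metis
  have "locus (\<lambda>x y z. y = 0) \<subseteq> {p. infinite {n \<in> UNIV. act n p = p}}"
  proof
    fix p assume "p \<in> locus (\<lambda>x y z. y = 0)"
    then obtain x z where p: "nonzero x 0 z" "p = pt x 0 z" by (auto simp: locus_def)
    have "act (N * k) p = p" for k
      unfolding act_def p(2) ep_power_act [OF p(1)] N by simp
    then have "range (\<lambda>k. N * k) \<subseteq> {n \<in> UNIV. act n p = p}" by auto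
    moreover have "infinite (range (\<lambda>k. N * k))"
      using N(1) finite_imageD [of "(*) N" UNIV] infinite_UNIV_int by (auto simp: inj_on_def)
    ultimately show "p \<in> {p. infinite {n \<in> UNIV. act n p = p}}" using finite_subset by blast
  qed
  then show L0: "kulkarni_L0 UNIV act = locus (\<lambda>x y z. y = 0)"
    using ep_power_L0_subset [of \<alpha> \<beta>] closure_subset unfolding kulkarni_L0_def act_def by blast
  show L1: "kulkarni_L1 UNIV act = {e1}"
  proof
    show "kulkarni_L1 UNIV act \<subseteq> {e1}"
      unfolding kulkarni_L1_def L0
      using ep_power_cluster_points_orbit [of _ \<alpha> \<beta>] closed_e1
      by (intro closure_minimal) (auto simp: act_def)
    have "e1 \<in> (\<Union>x \<in> - kulkarni_L0 UNIV act. cluster_points UNIV (\<lambda>n. {act n x}))"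
      unfolding L0 using e2_notin_line e1_cluster_point_ep_power by (intro UN_I [of e2]) (auto simp: act_def)
    then have "e1 \<in> kulkarni_L1 UNIV act"
      unfolding kulkarni_L1_def by (rule closure_subset [THEN subsetD])
    then show "{e1} \<subseteq> kulkarni_L1 UNIV act" by simp
  qed
  have "e1 \<in> locus (\<lambda>x y z. y = 0)"
    unfolding e1_def pt_in_locus_linear_iff [OF nonzero_e(1)] by simp
  then show "kulkarni_L2 UNIV act = {e1}"
    using ep_power_L2 [of \<alpha> \<beta>] unfolding L0 L1 act_def [symmetric] by (auto simp: insert_absorb)
qed

text \<open>In homogeneous coordinates the two conditions say that the complex, respectively the \<open>C j\<close>,
  component of \<open>x z^(-1)\<close> vanishes: the components of \<open>x\<close> times the quaternion conjugate of \<open>z\<close> are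
  the left-hand side of the first equation and the difference of the two sides of the second, and
  they scale by \<open>(norm a)\<^sup>2\<close>. In this form the conditions also make sense at \<open>e1\<close>, where \<open>x z^(-1)\<close>
  is not defined, and they cut out closed subsets of the whole plane.\<close>

lemma homogeneous_slice:
  "homogeneous (\<lambda>x y z. y = 0 \<and> qfst x * cnj (qfst z) + qsnd x * cnj (qsnd z) = 0)" (is "homogeneous ?A")
  "homogeneous (\<lambda>x y z. y = 0 \<and> qsnd x * qfst z = qfst x * qsnd z)" (is "homogeneous ?B")
proof -
  have *: "qfst (x * a) * cnj (qfst (z * a)) + qsnd (x * a) * cnj (qsnd (z * a))
      = (qfst x * cnj (qfst z) + qsnd x * cnj (qsnd z)) * (qfst a * cnj (qfst a) + qsnd a * cnj (qsnd a))"
    "qsnd (x * a) * qfst (z * a) - qfst (x * a) * qsnd (z * a)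
      = (qsnd x * qfst z - qfst x * qsnd z) * (qfst a * cnj (qfst a) + qsnd a * cnj (qsnd a))"
    for x z a
    by (simp_all add: algebra_simps)
  show "homogeneous ?A"
    unfolding homogeneous_def *(1) by simp
  show "homogeneous ?B"
  proof (rule homogeneousI)
    fix x y z a
    assume "?B x y z"
    then show "?B (x * a) (y * a) (z * a)" using *(2) [of x a z] by simp
  qed
qed

lemma closed_slice:
  "closed (locus (\<lambda>x y z. y = 0 \<and> qfst x * cnj (qfst z) + qsnd x * cnj (qsnd z) = 0))"
  "closed (locus (\<lambda>x y z. y = 0 \<and> qsnd x * qfst z = qfst x * qsnd z))"
  by (intro closed_locus homogeneous_slice closed_Collect_conj closed_Collect_eq continuous_intros)+

lemma irrational_sum_or_diff:
  assumes "\<alpha> \<notin> \<rat> \<or> \<beta> \<notin> (\<rat> :: real set)"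
  shows "\<alpha> - \<beta> \<notin> \<rat> \<or> \<alpha> + \<beta> \<notin> \<rat>"
proof (rule ccontr)
  assume "\<not> (\<alpha> - \<beta> \<notin> \<rat> \<or> \<alpha> + \<beta> \<notin> \<rat>)"
  then have "\<alpha> + \<beta> \<in> \<rat>" "\<alpha> - \<beta> \<in> \<rat>" by auto
  then have "((\<alpha> + \<beta>) + (\<alpha> - \<beta>)) / 2 \<in> \<rat>" "((\<alpha> + \<beta>) - (\<alpha> - \<beta>)) / 2 \<in> \<rat>"
    by (rule Rats_divide [OF Rats_add Rats_number_of], rule Rats_divide [OF Rats_diff Rats_number_of])
  moreover have "((\<alpha> + \<beta>) + (\<alpha> - \<beta>)) / 2 = \<alpha>" "((\<alpha> + \<beta>) - (\<alpha> - \<beta>)) / 2 = \<beta>"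
    by (simp_all add: field_simps)
  ultimately show False using assms by metis
qed

text \<open>Infinite isotropy provides a nonzero period \<open>n\<close>; an irrational rotation has none, so
  the component of \<open>w\<close> that is rotated irrationally must vanish.\<close>

lemma ep_power_infinite_isotropy:
  assumes "infinite {n \<in> UNIV. sl_act (ep_power \<alpha> \<beta> n) p = p}"
  obtains "p = e1" | w where "p = pt w 0 1" "\<alpha> - \<beta> \<notin> \<rat> \<Longrightarrow> qfst w = 0" "\<alpha> + \<beta> \<notin> \<rat> \<Longrightarrow> qsnd w = 0"
proof -
  obtain n where n: "n \<noteq> 0" "sl_act (ep_power \<alpha> \<beta> n) p = p"
    using assms
    by (metis (mono_tags, lifting) finite.emptyI finite_insert finite_subset insert_iff mem_Collect_eq subsetI)
  obtain x y z where p: "nonzero x y z" "p = pt x y z" by (rule pt_cases)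
  have y: "y = 0" using ep_power_fixed_point n p by metis
  show thesis
  proof (cases "z = 0")
    case True
    with p y show ?thesis using that(1) pt_eq_e1_iff by blast
  next
    case False
    define w where "w = x * inverse z"
    have pw: "p = pt w 0 1" using pt_normalize(3) [OF False, of x y] by (simp add: p y w_def)
    have "rot (of_int n * \<alpha>) * w = w * rot (of_int n * \<beta>)"
      using ep_power_fixed_point_on_line n(2) pw by metis
    note rot_intertwines [OF this, folded right_diff_distrib distrib_left]
    then show ?thesis using that(2) [OF pw] n(1) rot_mult_irrational_eq_1 by metis
  qed
qed

text \<open>One of the two rotation angles is irrational, so the points with infinite isotropy group all
  lie in one of the two closed slices, and their closure does too. A point with both components
  nonzero lies in neither slice.\<close>

lemma generic_notin_L0:
  assumes "\<alpha> \<notin> \<rat> \<or> \<beta> \<notin> \<rat>" "qfst w \<noteq> 0" "qsnd w \<noteq> 0"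
  shows "pt w 0 1 \<notin> kulkarni_L0 UNIV (\<lambda>n. sl_act (ep_power \<alpha> \<beta> n))"
proof -
  have nz: "nonzero v 0 1" for v by (simp add: nonzero_def)
  have avoid: ?thesis
    if hom: "homogeneous \<Phi>" and closed: "closed (locus \<Phi>)" and e1: "\<Phi> 1 0 0"
      and periodic: "\<And>v. (\<alpha> - \<beta> \<notin> \<rat> \<Longrightarrow> qfst v = 0) \<Longrightarrow> (\<alpha> + \<beta> \<notin> \<rat> \<Longrightarrow> qsnd v = 0) \<Longrightarrow> \<Phi> v 0 1"
      and w: "\<not> \<Phi> w 0 1" for \<Phi>
  proof -
    have "{p. infinite {n \<in> UNIV. sl_act (ep_power \<alpha> \<beta> n) p = p}} \<subseteq> locus \<Phi>"
    proof clarify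
      fix p assume "infinite {n \<in> UNIV. sl_act (ep_power \<alpha> \<beta> n) p = p}"
      then show "p \<in> locus \<Phi>"
      proof (cases rule: ep_power_infinite_isotropy)
        case 1
        then show ?thesis using e1 by (simp add: e1_def pt_in_locus_iff [OF hom nonzero_e(1)])
      next
        case (2 v)
        then show ?thesis using periodic by (simp add: pt_in_locus_iff [OF hom nz])
      qed
    qed
    then have "kulkarni_L0 UNIV (\<lambda>n. sl_act (ep_power \<alpha> \<beta> n)) \<subseteq> locus \<Phi>"
      unfolding kulkarni_L0_def by (intro closure_minimal closed)
    moreover have "pt w 0 1 \<notin> locus \<Phi>" using w by (simp add: pt_in_locus_iff [OF hom nz])
    ultimately show ?thesis by blast
  qed
  from irrational_sum_or_diff [OF assms(1)] show ?thesis
  proof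
    assume "\<alpha> - \<beta> \<notin> \<rat>"
    then show ?thesis
      by (intro avoid [OF homogeneous_slice(1) closed_slice(1)]) (use assms(2) in simp_all)
  next
    assume "\<alpha> + \<beta> \<notin> \<rat>"
    then show ?thesis
      by (intro avoid [OF homogeneous_slice(2) closed_slice(2)]) (use assms(3) in simp_all)
  qed
qed

text \<open>The image of \<open>[w : 0 : 1]\<close> depends continuously on the pair \<open>(l^n, m^n)\<close>, which returns
  infinitely often to any neighbourhood of \<open>(1, 1)\<close>.\<close>

lemma ep_power_recurrent:
  "pt w 0 1 \<in> cluster_points UNIV (\<lambda>n. {sl_act (ep_power \<alpha> \<beta> n) (pt w 0 1)})"
  unfolding cluster_points_def
proof clarify
  fix U assume U: "open U" "pt w 0 1 \<in> U"
    and fin: "finite {n \<in> UNIV. U \<inter> {sl_act (ep_power \<alpha> \<beta> n) (pt w 0 1)} \<noteq> {}}"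
  have nz: "nonzero w 0 1" by (simp add: nonzero_def)
  have "((\<lambda>p. pt (fst p * w) 0 (snd p)) \<longlongrightarrow> pt (fst (1, 1) * w) 0 (snd (1, 1))) (nhds (1, 1))"
    using nz tendsto_fst [OF filterlim_ident [of "nhds (1 :: quat, 1 :: quat)"]]
      tendsto_snd [OF filterlim_ident [of "nhds (1 :: quat, 1 :: quat)"]]
    by (intro tendsto_pt tendsto_mult tendsto_const) simp_all
  then have "eventually (\<lambda>p. pt (fst p * w) 0 (snd p) \<in> U) (nhds (1, 1))"
    using U by (intro topological_tendstoD) auto
  then obtain d where d: "d > 0" "\<And>p. dist p (1, 1) < d \<Longrightarrow> pt (fst p * w) 0 (snd p) \<in> U"
    unfolding eventually_nhds_metric by blast
  have "{n::int. norm (rot (of_int n * \<alpha>) - 1) < d / 2 \<and> norm (rot (of_int n * \<beta>) - 1) < d / 2}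
    \<subseteq> {n \<in> UNIV. U \<inter> {sl_act (ep_power \<alpha> \<beta> n) (pt w 0 1)} \<noteq> {}}"
  proof
    fix n :: int
    assume "n \<in> {n. norm (rot (of_int n * \<alpha>) - 1) < d / 2 \<and> norm (rot (of_int n * \<beta>) - 1) < d / 2}"
    then have n: "norm (rot (of_int n * \<alpha>) - 1) < d / 2" "norm (rot (of_int n * \<beta>) - 1) < d / 2"
      by auto
    let ?p = "(rot (of_int n * \<alpha>), rot (of_int n * \<beta>))"
    have "dist ?p (1, 1) \<le> norm (rot (of_int n * \<alpha>) - 1) + norm (rot (of_int n * \<beta>) - 1)"
      by (simp add: dist_norm norm_Pair_le)
    also have "\<dots> < d" using n by linarith
    finally have "pt (fst ?p * w) 0 (snd ?p) \<in> U" by (rule d(2))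
    then show "n \<in> {n \<in> UNIV. U \<inter> {sl_act (ep_power \<alpha> \<beta> n) (pt w 0 1)} \<noteq> {}}"
      by (simp add: ep_power_act [OF nz])
  qed
  then have "finite {n::int. norm (rot (of_int n * \<alpha>) - 1) < d / 2 \<and> norm (rot (of_int n * \<beta>) - 1) < d / 2}"
    using fin finite_subset by blast
  then show False using rot_recurrent [of "d / 2" \<alpha> \<beta>] d(1) by simp
qed

text \<open>Every point of the line is reached along a path of generic points, obtained by moving in the
  direction \<open>1 + j\<close>: starting at \<open>w\<close>, each component vanishes for at most one parameter value, and
  \<open>e1\<close> is the limit of \<open>[1 + j : 0 : t]\<close> as \<open>t\<close> tends to \<open>0\<close>.\<close>

lemma generic_dense_in_line:
  assumes S: "closed S" "\<And>w. qfst w \<noteq> 0 \<Longrightarrow> qsnd w \<noteq> 0 \<Longrightarrow> pt w 0 1 \<in> S"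
  shows "locus (\<lambda>x y z. y = 0) \<subseteq> S"
proof
  have generic: "pt x 0 z \<in> S" if "z \<noteq> 0" "qfst (x * inverse z) \<noteq> 0" "qsnd (x * inverse z) \<noteq> 0" for x z
    using S(2) [OF that(2,3)] pt_normalize(3) [OF that(1), of x 0] by simp
  fix p assume "p \<in> locus (\<lambda>x y z. y = 0)"
  then obtain x z where p: "nonzero x 0 z" "p = pt x 0 z" by (auto simp: locus_def)
  show "p \<in> S"
  proof (cases "z = 0")
    case True
    let ?u = "Quat 1 1"
    have u: "?u \<noteq> 0" by (simp add: quat_eq_iff)
    have "((\<lambda>t. pt ?u 0 (of_real t)) \<longlongrightarrow> pt ?u 0 (of_real 0)) (at_right (0::real))"
      using u by (intro tendsto_pt tendsto_intros) (simp add: nonzero_def)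
    moreover have "eventually (\<lambda>t. pt ?u 0 (of_real t) \<in> S) (at_right (0::real))"
    proof -
      have "pt ?u 0 (of_real t) \<in> S" if "t > 0" for t :: real
      proof (rule generic)
        have "?u * inverse (of_real t) = inverse t *\<^sub>R ?u"
          unfolding of_real_inverse [symmetric] by (simp add: of_real_def)
        then show "qfst (?u * inverse (of_real t)) \<noteq> 0" "qsnd (?u * inverse (of_real t)) \<noteq> 0"
          using that by simp_all
      qed (use that in simp)
      then show ?thesis by (rule eventually_mono [OF eventually_at_right_less])
    qed
    ultimately have "pt ?u 0 (of_real 0) \<in> S"
      by (intro Lim_in_closed_set [OF S(1) _ trivial_limit_at_right_real])
    then have "pt ?u 0 0 \<in> S" by simp
    moreover have "pt ?u 0 0 = e1" using u by (simp add: pt_eq_e1_iff nonzero_def)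
    moreover have "p = e1" using p True pt_eq_e1_iff by blast
    ultimately show ?thesis by simp
  next
    case False
    define w where "w = x * inverse z"
    have pw: "p = pt w 0 1" using pt_normalize(3) [OF False, of x 0] by (simp add: p w_def)
    let ?f = "\<lambda>t. w + t *\<^sub>R Quat 1 1"
    have "((\<lambda>t. pt (?f t) 0 1) \<longlongrightarrow> pt (w + 0 *\<^sub>R Quat 1 1) 0 1) (at_right 0)"
      by (intro tendsto_pt tendsto_intros) (simp add: nonzero_def)
    moreover have "eventually (\<lambda>t. pt (?f t) 0 1 \<in> S) (at_right 0)"
    proof -
      have ev: "eventually (\<lambda>t. t \<noteq> c) (at_right 0)" for c :: real
        unfolding eventually_at_right_field by (rule exI [of _ "if c > 0 then c else 1"]) auto
      have "eventually (\<lambda>t. t \<noteq> - Re (qfst w) \<and> t \<noteq> - Re (qsnd w)) (at_right 0)"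
        by (intro eventually_conj ev)
      then show ?thesis
      proof eventually_elim
        case (elim t)
        then have "qfst (?f t) \<noteq> 0" "qsnd (?f t) \<noteq> 0" by (auto simp: complex_eq_iff)
        then show ?case by (rule S(2))
      qed
    qed
    ultimately have "pt (w + 0 *\<^sub>R Quat 1 1) 0 1 \<in> S"
      by (intro Lim_in_closed_set [OF S(1) _ trivial_limit_at_right_real])
    then show ?thesis by (simp add: pw)
  qed
qed

lemma ep_power_irrational:
  fixes \<alpha> \<beta> :: real
  defines "act \<equiv> \<lambda>n. sl_act (ep_power \<alpha> \<beta> n)"
  assumes "\<alpha> \<notin> \<rat> \<or> \<beta> \<notin> \<rat>"
  shows "kulkarni_L1 UNIV act = locus (\<lambda>x y z. y = 0)"
    and "kulkarni_L2 UNIV act = {e1}"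
    and "\<alpha> + \<beta> \<notin> \<rat> \<Longrightarrow> \<alpha> - \<beta> \<notin> \<rat> \<Longrightarrow> kulkarni_L0 UNIV act = {e1, e3}"
proof -
  have cluster: "cluster_points UNIV (\<lambda>n. {act n p}) \<subseteq> locus (\<lambda>x y z. y = 0)" for p
  proof (cases "p \<in> locus (\<lambda>x y z. y = 0)")
    case True
    then obtain x z where p: "nonzero x 0 z" "p = pt x 0 z" by (auto simp: locus_def)
    have "act n p \<in> locus (\<lambda>x y z. y = 0)" for n
      unfolding act_def p(2) ep_power_act [OF p(1)]
        pt_in_locus_linear_iff [OF ep_power_act_nonzero [OF p(1)]] by simp
    then show ?thesis by (intro cluster_points_subset_closed closed_locus_linear) auto
  next
    case False
    have "e1 \<in> locus (\<lambda>x y z. y = 0)"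
      unfolding e1_def pt_in_locus_linear_iff [OF nonzero_e(1)] by simp
    then show ?thesis using ep_power_cluster_points_orbit [OF False, of \<alpha> \<beta>] by (auto simp: act_def)
  qed
  show L1: "kulkarni_L1 UNIV act = locus (\<lambda>x y z. y = 0)"
  proof
    show "kulkarni_L1 UNIV act \<subseteq> locus (\<lambda>x y z. y = 0)"
      unfolding kulkarni_L1_def using cluster by (intro closure_minimal closed_locus_linear) blast
    show "locus (\<lambda>x y z. y = 0) \<subseteq> kulkarni_L1 UNIV act"
    proof (rule generic_dense_in_line)
      show "closed (kulkarni_L1 UNIV act)" by (simp add: kulkarni_L1_def)
      fix w assume "qfst w \<noteq> 0" "qsnd w \<noteq> 0"
      then have "pt w 0 1 \<in> - kulkarni_L0 UNIV act"
        using generic_notin_L0 [OF assms(2)] by (simp add: act_def)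
      then have "pt w 0 1 \<in> (\<Union>x \<in> - kulkarni_L0 UNIV act. cluster_points UNIV (\<lambda>n. {act n x}))"
        by (rule UN_I) (unfold act_def, rule ep_power_recurrent)
      then show "pt w 0 1 \<in> kulkarni_L1 UNIV act"
        unfolding kulkarni_L1_def by (rule closure_subset [THEN subsetD])
    qed
  qed
  show "kulkarni_L2 UNIV act = {e1}"
    unfolding act_def
    by (rule ep_power_L2) (use ep_power_L0_subset [of \<alpha> \<beta>] L1 in \<open>auto simp: act_def\<close>)
  show "kulkarni_L0 UNIV act = {e1, e3}" if irr: "\<alpha> + \<beta> \<notin> \<rat>" "\<alpha> - \<beta> \<notin> \<rat>"
  proof -
    have "{p. infinite {n \<in> UNIV. act n p = p}} = {e1, e3}"
    proof
      show "{p. infinite {n \<in> UNIV. act n p = p}} \<subseteq> {e1, e3}"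
      proof
        fix p assume "p \<in> {p. infinite {n \<in> UNIV. act n p = p}}"
        then have "infinite {n \<in> UNIV. sl_act (ep_power \<alpha> \<beta> n) p = p}" by (simp add: act_def)
        then show "p \<in> {e1, e3}"
        proof (cases rule: ep_power_infinite_isotropy)
          case (2 w)
          with irr have "w = 0" by (simp add: quat_eq_iff)
          with 2 show ?thesis by (simp add: e3_def)
        qed simp
      qed
      show "{e1, e3} \<subseteq> {p. infinite {n \<in> UNIV. act n p = p}}"
        by (simp add: act_def ep_power_act_fixed_e1_e3)
    qed
    moreover have "closed {e1, e3}"
      using closed_Un [OF closed_e1 closed_e3] by (simp add: insert_commute)
    ultimately show ?thesis unfolding kulkarni_L0_def by simp
  qed
qed


section \<open>Ellipto-translation powers\<close>

definition et_power :: "real \<Rightarrow> int \<Rightarrow> quat^3^3" where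
  "et_power \<alpha> n = vector
    [vector [rot (of_int n * \<alpha>), of_int n *\<^sub>R rot (of_int (n - 1) * \<alpha>),
       (of_int n * of_int (n - 1) / 2) *\<^sub>R rot (of_int (n - 2) * \<alpha>)],
     vector [0, rot (of_int n * \<alpha>), of_int n *\<^sub>R rot (of_int (n - 1) * \<alpha>)],
     vector [0, 0, rot (of_int n * \<alpha>)]]"

lemma et_power_1:
  "et_power \<alpha> 1 = vector [vector [rot \<alpha>, 1, 0], vector [0, rot \<alpha>, 1], vector [0, 0, rot \<alpha>]]"
  by (simp add: et_power_def rot_0)

lemma one_parameter_et_power: "one_parameter (et_power \<alpha>)"
  unfolding one_parameter_def
proof (intro conjI allI)
  show "et_power \<alpha> 0 = mat 1"
    by (simp add: vec3_eq_iff et_power_def mat_def rot_0)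
  fix m n
  have args: "of_int m * \<alpha> + of_int (n - 1) * \<alpha> = of_int (m + n - 1) * \<alpha>"
    "of_int (m - 1) * \<alpha> + of_int n * \<alpha> = of_int (m + n - 1) * \<alpha>"
    "of_int m * \<alpha> + of_int (n - 2) * \<alpha> = of_int (m + n - 2) * \<alpha>"
    "of_int (m - 1) * \<alpha> + of_int (n - 1) * \<alpha> = of_int (m + n - 2) * \<alpha>"
    "of_int (m - 2) * \<alpha> + of_int n * \<alpha> = of_int (m + n - 2) * \<alpha>"
    by (simp_all add: algebra_simps)
  have coeff: "of_int (m + n) * of_int (m + n - 1) / 2 =
      of_int n * of_int (n - 1) / 2 + of_int m * of_int n + (of_int m * of_int (m - 1) / 2 :: real)"
    by (simp add: field_simps)
  show "et_power \<alpha> (m + n) = et_power \<alpha> m ** et_power \<alpha> n"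
    unfolding et_power_def coeff
    by (simp add: vec3_eq_iff matrix_matrix_mult_def sum_3 rot_mult args
        scaleR_add_left distrib_right del: of_int_diff)
qed

context
  fixes \<alpha> :: real
begin

text \<open>The first two coordinates of the image under the \<open>n\<close>-th power.\<close>

definition et_x :: "int \<Rightarrow> quat \<Rightarrow> quat \<Rightarrow> quat \<Rightarrow> quat" where
  "et_x n x y z = rot (of_int n * \<alpha>) * x + of_int n *\<^sub>R (rot (of_int (n - 1) * \<alpha>) * y)
     + (of_int n * of_int (n - 1) / 2) *\<^sub>R (rot (of_int (n - 2) * \<alpha>) * z)"

definition et_y :: "int \<Rightarrow> quat \<Rightarrow> quat \<Rightarrow> quat" where
  "et_y n y z = rot (of_int n * \<alpha>) * y + of_int n *\<^sub>R (rot (of_int (n - 1) * \<alpha>) * z)"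

lemma et_power_act:
  assumes "nonzero x y z"
  shows "sl_act (et_power \<alpha> n) (pt x y z) = pt (et_x n x y z) (et_y n y z) (rot (of_int n * \<alpha>) * z)"
  unfolding one_parameter_act_pt [OF one_parameter_et_power assms] abs_p2h_eq_pt
  by (simp add: et_power_def matrix_vector_mult_def sum_3 et_x_def et_y_def)

lemma et_power_act_nonzero:
  assumes "nonzero x y z"
  shows "nonzero (et_x n x y z) (et_y n y z) (rot (of_int n * \<alpha>) * z)"
  using assms rot_nonzero by (auto simp: nonzero_def et_x_def et_y_def)

lemma et_power_act_eq_iff:
  assumes "nonzero x y z"
  shows "sl_act (et_power \<alpha> n) (pt x y z) = pt x y z \<longleftrightarrow>
    (\<exists>a. a \<noteq> 0 \<and> et_x n x y z = x * a \<and> et_y n y z = y * a \<and> rot (of_int n * \<alpha>) * z = z * a)"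
  unfolding et_power_act [OF assms] pt_eq_iff [OF assms et_power_act_nonzero [OF assms], symmetric]
  by (rule eq_commute)

lemma et_power_act_e2:
  "sl_act (et_power \<alpha> n) e2 = pt (of_int n *\<^sub>R rot (of_int (n - 1) * \<alpha>)) (rot (of_int n * \<alpha>)) 0"
  by (simp add: e2_def et_power_act [OF nonzero_e(2)] et_x_def et_y_def)

lemma e1_cluster_point_et_power: "e1 \<in> cluster_points UNIV (\<lambda>n. {sl_act (et_power \<alpha> n) e2})"
  unfolding et_power_act_e2 by (rule e1_cluster_point) simp

lemma et_power_act_e1: "sl_act (et_power \<alpha> n) e1 = e1"
proof -
  have "sl_act (et_power \<alpha> n) (pt 1 0 0) = e1"
    unfolding et_power_act [OF nonzero_e(1)] pt_eq_e1_iff [OF et_power_act_nonzero [OF nonzero_e(1)]]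
    by (simp add: et_y_def)
  then show ?thesis by (simp add: e1_def)
qed

text \<open>The commutator argument excludes first \<open>z \<noteq> 0\<close>, by the second coordinate, and then \<open>y \<noteq> 0\<close>, by
  the first one.\<close>

lemma et_power_fixed_point:
  assumes "n \<noteq> 0" "sl_act (et_power \<alpha> n) p = p"
  shows "p = e1"
proof -
  obtain x y z where p: "nonzero x y z" "p = pt x y z" by (rule pt_cases)
  have z: "z = 0"
  proof (rule ccontr)
    assume "z \<noteq> 0"
    define u v where "u = x * inverse z" and "v = y * inverse z"
    have pz: "p = pt u v 1" unfolding p(2) u_def v_def by (rule pt_normalize(3) [OF \<open>z \<noteq> 0\<close>])
    have nz: "nonzero u v 1" by (simp add: nonzero_def)
    from assms(2) have "rot (of_int n * \<alpha>) * v + of_int n *\<^sub>R rot (of_int (n - 1) * \<alpha>) = v * rot (of_int n * \<alpha>)"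
      unfolding pz et_power_act_eq_iff [OF nz] by (auto simp: et_y_def)
    then have "real_of_int n = 0" by (rule rot_translation_fixed)
    with assms(1) show False by simp
  qed
  have y: "y = 0"
  proof (rule ccontr)
    assume "y \<noteq> 0"
    define u where "u = x * inverse y"
    have py: "p = pt u 1 0" unfolding p(2) u_def z using pt_normalize(2) [OF \<open>y \<noteq> 0\<close>, of x 0] by simp
    have nz: "nonzero u 1 0" by (simp add: nonzero_def)
    from assms(2) have "rot (of_int n * \<alpha>) * u + of_int n *\<^sub>R rot (of_int (n - 1) * \<alpha>) = u * rot (of_int n * \<alpha>)"
      unfolding py et_power_act_eq_iff [OF nz] by (auto simp: et_x_def et_y_def)
    then have "real_of_int n = 0" by (rule rot_translation_fixed)
    with assms(1) show False by simp
  qed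
  show ?thesis using pt_eq_e1_iff [OF p(1)] y z p(2) by simp
qed

lemma et_power_L0: "kulkarni_L0 UNIV (\<lambda>n. sl_act (et_power \<alpha> n)) = {e1}"
proof -
  have "{p. infinite {n \<in> UNIV. sl_act (et_power \<alpha> n) p = p}} = {e1}"
  proof
    show "{p. infinite {n \<in> UNIV. sl_act (et_power \<alpha> n) p = p}} \<subseteq> {e1}"
    proof
      fix p assume "p \<in> {p. infinite {n \<in> UNIV. sl_act (et_power \<alpha> n) p = p}}"
      then have inf: "infinite {n \<in> UNIV. sl_act (et_power \<alpha> n) p = p}" by simp
      have "p = e1"
      proof (rule ccontr)
        assume "p \<noteq> e1"
        then have "{n \<in> UNIV. sl_act (et_power \<alpha> n) p = p} \<subseteq> {0}"
          using et_power_fixed_point by auto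
        then have "finite {n \<in> UNIV. sl_act (et_power \<alpha> n) p = p}" by (rule finite_subset) simp
        with inf show False by simp
      qed
      then show "p \<in> {e1}" by simp
    qed
  qed (simp add: et_power_act_e1)
  then show ?thesis by (simp add: kulkarni_L0_def closed_e1)
qed

lemma quadratic_bound:
  fixes t a b :: real
  assumes "0 \<le> a" "0 \<le> b" "0 \<le> t" "t * (t - 1) / 2 \<le> a * t + b"
  shows "t \<le> 1 + 2 * a + 2 * b"
proof (rule ccontr)
  assume "\<not> t \<le> 1 + 2 * a + 2 * b"
  then have t: "t > 1 + 2 * a + 2 * b" by simp
  then have "t * (2 * a + 2 * b) < t * (t - 1)"
    using assms by (intro mult_strict_left_mono) linarith+
  moreover have "2 * b \<le> 2 * b * t" using t assms by (simp add: mult_le_cancel_left1)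
  ultimately show False using assms(4) by (simp add: algebra_simps)
qed

text \<open>For \<open>z = 1\<close> the term quadratic in \<open>n\<close> dominates the first coordinate, while the others grow at
  most linearly. The bound on \<open>n\<close> depends only on \<open>R\<close> and on a bound \<open>M\<close> for the affine
  coordinates; this uniformity is used for single orbits and, with the exponent negated, for compact sets.\<close>

lemma et_power_escape:
  assumes "0 \<le> R" "norm x \<le> M" "norm y \<le> M"
    and "sl_act (et_power \<alpha> n) (pt x y 1) \<in> locus (\<lambda>x y z. norm x < R * (norm y + norm z))"
  shows "\<bar>real_of_int n\<bar> \<le> 1 + 2 * (M + R) + 2 * (M + R * (M + 1))"
proof -
  have nz: "nonzero x y 1" by (simp add: nonzero_def)
  have "0 \<le> M" using assms(2) norm_ge_zero order_trans by blast
  let ?t = "\<bar>real_of_int n\<bar>"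
  have less: "norm (et_x n x y 1) < R * (norm (et_y n y 1) + 1)"
    using assms(4) unfolding et_power_act [OF nz] pt_in_locus_norm_less_iff(1) [OF et_power_act_nonzero [OF nz]]
    by (simp add: norm_mult norm_rot)
  have "norm (et_y n y 1) \<le> norm (rot (of_int n * \<alpha>) * y) + norm (of_int n *\<^sub>R rot (of_int (n - 1) * \<alpha>))"
    unfolding et_y_def mult_1_right by (rule norm_triangle_ineq)
  also have "\<dots> \<le> M + ?t" using assms(3) by (simp add: norm_mult norm_rot)
  finally have y': "R * (norm (et_y n y 1) + 1) \<le> R * (M + ?t + 1)"
    using assms(1) by (intro mult_left_mono) auto
  let ?a = "rot (of_int n * \<alpha>) * x" and ?b = "of_int n *\<^sub>R (rot (of_int (n - 1) * \<alpha>) * y)"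
    and ?c = "(of_int n * of_int (n - 1) / 2) *\<^sub>R rot (of_int (n - 2) * \<alpha>)"
  have "?c = et_x n x y 1 - ?a - ?b" by (simp add: et_x_def)
  then have "norm ?c \<le> norm (et_x n x y 1) + norm ?a + norm ?b"
    using norm_triangle_ineq4 [of "et_x n x y 1 - ?a" ?b] norm_triangle_ineq4 [of "et_x n x y 1" ?a] by simp
  also have "norm ?a \<le> M" using assms(2) by (simp add: norm_mult norm_rot)
  also have "norm ?b \<le> ?t * M" using assms(3) by (simp add: norm_mult norm_rot mult_left_mono)
  finally have "norm ?c \<le> norm (et_x n x y 1) + M + ?t * M" by simp
  moreover have "?t * (?t - 1) / 2 \<le> norm ?c"
  proof -
    have "?t * (?t - 1) \<le> ?t * \<bar>real_of_int (n - 1)\<bar>" by (intro mult_left_mono) auto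
    then show ?thesis by (simp add: norm_rot abs_mult)
  qed
  ultimately have "?t * (?t - 1) / 2 \<le> R * (M + ?t + 1) + M + ?t * M"
    using less y' by linarith
  then have "?t * (?t - 1) / 2 \<le> (M + R) * ?t + (M + R * (M + 1))"
    by (simp add: algebra_simps)
  then show ?thesis using assms(1) \<open>0 \<le> M\<close> by (intro quadratic_bound) auto
qed

text \<open>On the line \<open>z = 0\<close> the quadratic term is absent and linear growth of the first coordinate,
  against a constant second one, does the same job.\<close>

lemma et_power_escape_affine:
  assumes "0 \<le> R" "norm x \<le> M"
    and "sl_act (et_power \<alpha> n) (pt x 1 0) \<in> locus (\<lambda>x y z. norm x < R * (norm y + norm z))"
  shows "\<bar>real_of_int n\<bar> \<le> M + R"
proof -
  have nz: "nonzero x 1 0" by (simp add: nonzero_def)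
  have less: "norm (et_x n x 1 0) < R"
    using assms(3) unfolding et_power_act [OF nz] pt_in_locus_norm_less_iff(1) [OF et_power_act_nonzero [OF nz]]
    by (simp add: norm_mult norm_rot et_y_def)
  have "of_int n *\<^sub>R rot (of_int (n - 1) * \<alpha>) = et_x n x 1 0 - rot (of_int n * \<alpha>) * x"
    by (simp add: et_x_def)
  then have "norm (of_int n *\<^sub>R rot (of_int (n - 1) * \<alpha>)) \<le> norm (et_x n x 1 0) + norm (rot (of_int n * \<alpha>) * x)"
    using norm_triangle_ineq4 by metis
  then show ?thesis using less assms(2) by (simp add: norm_mult norm_rot)
qed

lemma et_power_cluster_points_orbit:
  assumes "p \<noteq> e1"
  shows "cluster_points UNIV (\<lambda>n. {sl_act (et_power \<alpha> n) p}) \<subseteq> {e1}"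
proof (rule cluster_points_subset_e1)
  fix R :: real assume R: "0 \<le> R"
  let ?U = "locus (\<lambda>x y z. norm x < R * (norm y + norm z))"
  obtain x y z where p: "nonzero x y z" "p = pt x y z" by (rule pt_cases)
  have "\<exists>B. \<forall>n. sl_act (et_power \<alpha> n) p \<in> ?U \<longrightarrow> \<bar>real_of_int n\<bar> \<le> B"
  proof (cases "z = 0")
    case False
    then have "p = pt (x * inverse z) (y * inverse z) 1" unfolding p(2) by (rule pt_normalize(3))
    then show ?thesis
      using et_power_escape [OF R, of "x * inverse z" "max (norm (x * inverse z)) (norm (y * inverse z))" "y * inverse z"]
      by (intro exI) auto
  next
    case True
    with p assms have "y \<noteq> 0" using pt_eq_e1_iff by metis
    then have "p = pt (x * inverse y) 1 0" using pt_normalize(2) [of y x 0] p(2) True by simp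
    then show ?thesis using et_power_escape_affine [OF R order_refl] by auto
  qed
  then obtain B where "\<And>n. sl_act (et_power \<alpha> n) p \<in> ?U \<Longrightarrow> \<bar>real_of_int n\<bar> \<le> B" by blast
  then show "finite {n. ?U \<inter> {sl_act (et_power \<alpha> n) p} \<noteq> {}}"
    by (intro finite_subset [OF _ finite_int_bounded [of B]]) auto
qed

lemma e2_neq_e1: "e2 \<noteq> e1"
  unfolding e2_def pt_eq_e1_iff [OF nonzero_e(2)] by simp

lemma et_power_L1: "kulkarni_L1 UNIV (\<lambda>n. sl_act (et_power \<alpha> n)) = {e1}"
proof
  show "kulkarni_L1 UNIV (\<lambda>n. sl_act (et_power \<alpha> n)) \<subseteq> {e1}"
    unfolding kulkarni_L1_def et_power_L0
    using et_power_cluster_points_orbit by (intro closure_minimal [OF _ closed_e1]) blast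
  have "e1 \<in> (\<Union>x \<in> - {e1}. cluster_points UNIV (\<lambda>n. {sl_act (et_power \<alpha> n) x}))"
    using e2_neq_e1 e1_cluster_point_et_power by (intro UN_I [of e2]) auto
  then have "e1 \<in> kulkarni_L1 UNIV (\<lambda>n. sl_act (et_power \<alpha> n))"
    unfolding kulkarni_L1_def et_power_L0 by (rule closure_subset [THEN subsetD])
  then show "{e1} \<subseteq> kulkarni_L1 UNIV (\<lambda>n. sl_act (et_power \<alpha> n))" by simp
qed

text \<open>Points near \<open>p\<close> with \<open>z \<noteq> 0\<close> have bounded affine coordinates. If the \<open>n\<close>-th power carries a
  point of \<open>K\<close> to such a point, then the power with exponent \<open>- n\<close> carries it back into
  \<open>K\<close>, where \<open>norm x < R * (norm y + norm z)\<close>; the escape estimate bounds \<open>n\<close>.\<close>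

lemma et_power_cluster_points_compact:
  assumes "compact K" "e1 \<notin> K"
  shows "cluster_points UNIV (\<lambda>n. sl_act (et_power \<alpha> n) ` K) \<subseteq> locus (\<lambda>x y z. z = 0)"
proof
  fix p assume p: "p \<in> cluster_points UNIV (\<lambda>n. sl_act (et_power \<alpha> n) ` K)"
  obtain R where R: "0 \<le> R" "K \<subseteq> locus (\<lambda>x y z. norm x < R * (norm y + norm z))"
    using compact_bounded_off_e1 [OF assms] by metis
  obtain x y z where xyz: "nonzero x y z" "p = pt x y z" by (rule pt_cases)
  show "p \<in> locus (\<lambda>x y z. z = 0)"
  proof (rule ccontr)
    assume "p \<notin> locus (\<lambda>x y z. z = 0)"
    then have "z \<noteq> 0" using pt_in_locus_linear_iff(2) [OF xyz(1)] xyz(2) by simp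
    then obtain m :: nat where "norm x + norm y < real m * norm z"
      using ex_nat_mult_greater [of "norm z" "norm x + norm y"] by auto
    let ?V = "locus (\<lambda>x y z. norm x + norm y < real m * norm z)"
    have "p \<in> ?V"
      using \<open>norm x + norm y < real m * norm z\<close> xyz pt_in_locus_norm_less_iff(3) by simp
    with p have "infinite {n \<in> UNIV. ?V \<inter> sl_act (et_power \<alpha> n) ` K \<noteq> {}}"
      using open_locus_norm_less(3) unfolding cluster_points_def by blast
    moreover have "\<bar>real_of_int n\<bar> \<le> 1 + 2 * (real m + R) + 2 * (real m + R * (real m + 1))"
      if n: "?V \<inter> sl_act (et_power \<alpha> n) ` K \<noteq> {}" for n
    proof -
      from n obtain k where k: "k \<in> K" "sl_act (et_power \<alpha> n) k \<in> ?V" by blast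
      obtain x y z where q: "nonzero x y z" "sl_act (et_power \<alpha> n) k = pt x y z" by (rule pt_cases)
      have lt: "norm x + norm y < real m * norm z"
        using k(2) q pt_in_locus_norm_less_iff(3) by simp
      have "z \<noteq> 0"
      proof
        assume "z = 0"
        with lt norm_ge_zero [of x] norm_ge_zero [of y] show False by simp
      qed
      have "norm x \<le> real m * norm z" "norm y \<le> real m * norm z"
        using lt norm_ge_zero [of x] norm_ge_zero [of y] by linarith+
      moreover have "norm (u * inverse z) = norm u / norm z" for u
        by (simp only: norm_mult norm_inverse divide_inverse)
      ultimately have bd: "norm (x * inverse z) \<le> m" "norm (y * inverse z) \<le> m"
        using \<open>z \<noteq> 0\<close> by (simp_all only: divide_le_eq) simp_all
      have "sl_act (et_power \<alpha> (- n)) (pt (x * inverse z) (y * inverse z) 1) = k"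
        using one_parameter_act_inverse [OF one_parameter_et_power, of \<alpha> n k]
          pt_normalize(3) [OF \<open>z \<noteq> 0\<close>, of x y] q(2) by simp
      then show ?thesis
        using et_power_escape [OF R(1) bd, of "- n"] k(1) R(2) by auto
    qed
    then have "finite {n \<in> UNIV. ?V \<inter> sl_act (et_power \<alpha> n) ` K \<noteq> {}}"
      by (intro finite_subset [OF _ finite_int_bounded [of "1 + 2 * (real m + R) + 2 * (real m + R * (real m + 1))"]]) auto
    ultimately show False by blast
  qed
qed

text \<open>The constant \<open>c = - 2 / (n - 1)\<close> makes \<open>n(n-1)/2 * c = - n\<close>, so that the quadratic term cancels
  the linear one in the first coordinate, while the second is multiplied by
  \<open>1 + n c\<close>, which tends to \<open>- 1\<close>. Conjugating \<open>x\<close> by \<open>l^n\<close> beforehand undoes the conjugation that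
  the renormalization from the right would produce.\<close>

lemma et_power_witness:
  fixes k :: nat and x :: quat and c :: real
  defines "n \<equiv> int (k + 2)" and "c \<equiv> - 2 / real (k + 1)"
  shows "sl_act (et_power \<alpha> n) (pt (rot (- of_int n * \<alpha>) * x * rot (of_int n * \<alpha>)) 1 (c *\<^sub>R rot \<alpha>))
    = pt x (of_real (1 + (real k + 2) * c)) (c *\<^sub>R rot \<alpha>)"
proof -
  let ?x = "rot (- of_int n * \<alpha>) * x * rot (of_int n * \<alpha>)" and ?z = "c *\<^sub>R rot \<alpha>"
  let ?L = "rot (of_int n * \<alpha>)"
  have c: "of_int (n - 1) * c = - 2" by (simp add: n_def c_def field_simps)
  have nz: "nonzero ?x 1 ?z" by (simp add: nonzero_def)
  have "rot (of_int (n - 2) * \<alpha>) * rot \<alpha> = rot (of_int (n - 1) * \<alpha>)"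
    "rot (of_int (n - 1) * \<alpha>) * rot \<alpha> = ?L" "rot \<alpha> * ?L = ?L * rot \<alpha>"
    by (simp_all add: rot_mult algebra_simps)
  note rots = this
  have "?L * ?x = x * ?L"
    by (simp add: rot_mult rot_0 flip: mult.assoc)
  moreover have "(of_int n * of_int (n - 1) / 2) *\<^sub>R (rot (of_int (n - 2) * \<alpha>) * ?z)
      = - (of_int n *\<^sub>R rot (of_int (n - 1) * \<alpha>))"
  proof -
    have "(of_int n * of_int (n - 1) / 2) * c = of_int n * (of_int (n - 1) * c) / 2" by simp
    also have "\<dots> = - of_int n" unfolding c by simp
    finally have "(of_int n * of_int (n - 1) / 2) * c = - of_int n" .
    then show ?thesis by (simp add: rots del: of_int_diff)
  qed
  ultimately have X: "et_x n ?x 1 ?z = x * ?L"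
    by (simp add: et_x_def)
  have Y: "et_y n 1 ?z = of_real (1 + (real k + 2) * c) * ?L"
  proof -
    have "et_y n 1 ?z = ?L + (of_int n * c) *\<^sub>R ?L"
      by (simp add: et_y_def rots del: of_int_diff)
    also have "\<dots> = (1 + (real k + 2) * c) *\<^sub>R ?L" by (simp add: n_def scaleR_add_left)
    finally show ?thesis by (simp add: of_real_def)
  qed
  have "nonzero x (of_real (1 + (real k + 2) * c)) ?z"
    using rot_nonzero by (simp add: nonzero_def c_def)
  moreover have "rot (of_int n * \<alpha>) * ?z = ?z * ?L" by (simp add: rots)
  ultimately show ?thesis
    unfolding et_power_act [OF nz] using et_power_act_nonzero [OF nz, of n] X Y rot_nonzero
    by (subst eq_commute, subst pt_eq_iff) auto
qed

lemma et_power_L2: "kulkarni_L2 UNIV (\<lambda>n. sl_act (et_power \<alpha> n)) = locus (\<lambda>x y z. z = 0)"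
proof
  let ?act = "\<lambda>n. sl_act (et_power \<alpha> n)"
  show "kulkarni_L2 UNIV ?act \<subseteq> locus (\<lambda>x y z. z = 0)"
    unfolding kulkarni_L2_def et_power_L0 et_power_L1
    using et_power_cluster_points_compact by (intro closure_minimal closed_locus_linear) blast
  have in_L2: "p \<in> kulkarni_L2 UNIV ?act"
    if "compact K" "e1 \<notin> K" "p \<in> cluster_points UNIV (\<lambda>n. ?act n ` K)" for K p
  proof -
    have "p \<in> (\<Union>K \<in> {K. compact K \<and> K \<subseteq> - ({e1} \<union> {e1})}. cluster_points UNIV (\<lambda>n. ?act n ` K))"
      using that by blast
    then show ?thesis
      unfolding kulkarni_L2_def et_power_L0 et_power_L1 by (rule closure_subset [THEN subsetD])
  qed
  show "locus (\<lambda>x y z. z = 0) \<subseteq> kulkarni_L2 UNIV ?act"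
  proof
    fix p assume "p \<in> locus (\<lambda>x y z. z = 0)"
    then obtain u y where p: "nonzero u y 0" "p = pt u y 0" by (auto simp: locus_def)
    show "p \<in> kulkarni_L2 UNIV ?act"
    proof (cases "y = 0")
      case True
      then have "p = e1" using p pt_eq_e1_iff by simp
      then show ?thesis
        using in_L2 [of "{e2}" e1] e2_neq_e1 e1_cluster_point_et_power by auto
    next
      case False
      define x where "x = - (u * inverse y)"
      have px: "p = pt x (- 1) 0"
        unfolding p(2) using False
        by (subst pt_eq_iff) (auto simp: nonzero_def x_def intro!: exI [of _ "- inverse y"])
      define K where "K = (\<lambda>(v, w). pt v 1 w) ` (cball 0 (norm x) \<times> cball 0 2)"
      have "continuous_on (cball 0 (norm x) \<times> cball 0 2) (\<lambda>(v, w). pt v 1 w)"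
        unfolding continuous_on_def split_def
        by (intro ballI tendsto_pt tendsto_intros) (simp_all add: nonzero_def)
      then have "compact K"
        unfolding K_def by (intro compact_continuous_image compact_Times compact_cball_quat)
      moreover have "e1 \<notin> K"
      proof
        assume "e1 \<in> K"
        then obtain v w where "e1 = pt v 1 w" by (auto simp: K_def)
        moreover have "pt v 1 w \<noteq> e1" by (subst pt_eq_e1_iff) (simp_all add: nonzero_def)
        ultimately show False by simp
      qed
      moreover have "p \<in> cluster_points UNIV (\<lambda>n. ?act n ` K)"
      proof (rule cluster_points_tendsto [where j = 2])
        let ?c = "\<lambda>k. - 2 / real (k + 1)"
        have c: "?c \<longlonglongrightarrow> 0"
          using tendsto_mult [OF tendsto_const [of "- 2"] LIMSEQ_inverse_real_of_nat]
          by (simp add: divide_inverse)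
        have "(\<lambda>k. - 1 + ?c k) \<longlonglongrightarrow> - 1 + 0" by (intro tendsto_add tendsto_const c)
        moreover have "- 1 + ?c k = 1 + (real k + 2) * ?c k" for k
          by (simp add: field_simps)
        ultimately have "(\<lambda>k. 1 + (real k + 2) * ?c k) \<longlonglongrightarrow> - 1"
          by (simp only: add_0_right)
        then have "(\<lambda>k. of_real (1 + (real k + 2) * ?c k) :: quat) \<longlonglongrightarrow> of_real (- 1)"
          by (rule tendsto_of_real)
        moreover have "(\<lambda>k. ?c k *\<^sub>R rot \<alpha>) \<longlonglongrightarrow> 0 *\<^sub>R rot \<alpha>"
          by (intro tendsto_scaleR c tendsto_const)
        ultimately show "(\<lambda>k. pt x (of_real (1 + (real k + 2) * ?c k)) (?c k *\<^sub>R rot \<alpha>)) \<longlonglongrightarrow> p"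
          unfolding px by (intro tendsto_pt tendsto_const) (simp_all add: nonzero_def)
        fix k
        let ?n = "int (k + 2)"
        have "norm (?c k *\<^sub>R rot \<alpha>) \<le> 2" by (simp add: norm_rot field_simps)
        then have "pt (rot (- of_int ?n * \<alpha>) * x * rot (of_int ?n * \<alpha>)) 1 (?c k *\<^sub>R rot \<alpha>) \<in> K"
          unfolding K_def by (intro rev_image_eqI [OF SigmaI]) (simp_all add: norm_mult norm_rot)
        then show "pt x (of_real (1 + (real k + 2) * ?c k)) (?c k *\<^sub>R rot \<alpha>) \<in> ?act ?n ` K"
          using et_power_witness [of k x] by (metis imageI)
      qed
      ultimately show ?thesis by (rule in_L2)
    qed
  qed
qed

end

section \<open>The Kulkarni sets of parabolic transformations\<close>

lemma ep_power_eq_one: "ep_power \<alpha> \<beta> n = mat 1 \<or> ep_power \<alpha> \<beta> n = - mat 1 \<Longrightarrow> n = 0"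
  and et_power_eq_one: "et_power \<alpha> n = mat 1 \<or> et_power \<alpha> n = - mat 1 \<Longrightarrow> n = 0"
proof -
  have "(mat 1 :: quat^3^3) $ 1 $ 2 = 0" by (simp add: mat_def)
  moreover have "ep_power \<alpha> \<beta> n $ 1 $ 2 = of_int n *\<^sub>R rot (of_int (n - 1) * \<alpha>)"
    "et_power \<alpha> n $ 1 $ 2 = of_int n *\<^sub>R rot (of_int (n - 1) * \<alpha>)"
    by (simp_all add: ep_power_def et_power_def)
  moreover have "n = 0" if "of_int n *\<^sub>R rot (of_int (n - 1) * \<alpha>) = 0"
    using that rot_nonzero by simp
  ultimately show "ep_power \<alpha> \<beta> n = mat 1 \<or> ep_power \<alpha> \<beta> n = - mat 1 \<Longrightarrow> n = 0"
    "et_power \<alpha> n = mat 1 \<or> et_power \<alpha> n = - mat 1 \<Longrightarrow> n = 0"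
    by (metis neg_equal_0_iff_equal vector_uminus_component)+
qed


theorem theorem5p1:
  fixes gt :: "(quat^3^3) set" and g :: "quat^3^3" and \<alpha> \<beta> :: real
  assumes "gt \<in> carrier PSL3H" and "parabolic gt" and "is_lift g gt"
  shows
    "(g = vector [vector [1, 1, 0], vector [0, 1, 0], vector [0, 0, 1]] \<longrightarrow>
        kulkarni_L0 (cyclic_group gt) psl_act = proj_line e1 e3 \<and>
        kulkarni_L1 (cyclic_group gt) psl_act = {e1} \<and>
        kulkarni_L2 (cyclic_group gt) psl_act = {e1}) \<and>
     (g = vector [vector [1, 1, 0], vector [0, 1, 1], vector [0, 0, 1]] \<longrightarrow>
        kulkarni_L0 (cyclic_group gt) psl_act = {e1} \<and>
        kulkarni_L1 (cyclic_group gt) psl_act = {e1} \<and>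
        kulkarni_L2 (cyclic_group gt) psl_act = proj_line e1 e2) \<and>
     (g = vector [vector [rot \<alpha>, 1, 0], vector [0, rot \<alpha>, 0], vector [0, 0, rot \<beta>]] \<and>
      rot \<alpha> \<noteq> 1 \<longrightarrow>
        kulkarni_L2 (cyclic_group gt) psl_act = {e1} \<and>
        (\<alpha> \<in> \<rat> \<and> \<beta> \<in> \<rat> \<longrightarrow>
          kulkarni_L0 (cyclic_group gt) psl_act = proj_line e1 e3 \<and>
          kulkarni_L1 (cyclic_group gt) psl_act = {e1}) \<and>
        (\<alpha> \<notin> \<rat> \<or> \<beta> \<notin> \<rat> \<longrightarrow>
          (\<alpha> + \<beta> \<notin> \<rat> \<and> \<alpha> - \<beta> \<notin> \<rat> \<longrightarrow>
            kulkarni_L0 (cyclic_group gt) psl_act = {e1, e3}) \<and>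
          kulkarni_L1 (cyclic_group gt) psl_act = proj_line e1 e3)) \<and>
     (g = vector [vector [rot \<alpha>, 1, 0], vector [0, rot \<alpha>, 1], vector [0, 0, rot \<alpha>]] \<longrightarrow>
        kulkarni_L0 (cyclic_group gt) psl_act = {e1} \<and>
        kulkarni_L1 (cyclic_group gt) psl_act = {e1} \<and>
        kulkarni_L2 (cyclic_group gt) psl_act = proj_line e1 e2)"
proof -
  let ?L0 = "kulkarni_L0 (cyclic_group gt) psl_act"
  let ?L1 = "kulkarni_L1 (cyclic_group gt) psl_act"
  let ?L2 = "kulkarni_L2 (cyclic_group gt) psl_act"
  have ep_rational: "?L0 = proj_line e1 e3 \<and> ?L1 = {e1} \<and> ?L2 = {e1}"
    if "g = ep_power a b 1" "a \<in> \<rat>" "b \<in> \<rat>" for a b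
    using kulkarni_one_parameter [OF one_parameter_ep_power _ ep_power_eq_one, of a b gt]
      ep_power_rational [OF that(2,3)] assms(3) that(1)
    by (simp add: proj_line_e1_e3)
  have ep_irrational: "?L1 = proj_line e1 e3 \<and> ?L2 = {e1} \<and>
      (a + b \<notin> \<rat> \<and> a - b \<notin> \<rat> \<longrightarrow> ?L0 = {e1, e3})"
    if "g = ep_power a b 1" "a \<notin> \<rat> \<or> b \<notin> \<rat>" for a b
    using kulkarni_one_parameter [OF one_parameter_ep_power _ ep_power_eq_one, of a b gt]
      ep_power_irrational [OF that(2)] assms(3) that(1)
    by (simp add: proj_line_e1_e3)
  have et: "?L0 = {e1} \<and> ?L1 = {e1} \<and> ?L2 = proj_line e1 e2" if "g = et_power a 1" for a
    using kulkarni_one_parameter [OF one_parameter_et_power _ et_power_eq_one, of a gt]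
      et_power_L0 [of a] et_power_L1 [of a] et_power_L2 [of a] assms(3) that
    by (simp add: proj_line_e1_e2)
  have i: "?L0 = proj_line e1 e3 \<and> ?L1 = {e1} \<and> ?L2 = {e1}"
    if "g = vector [vector [1, 1, 0], vector [0, 1, 0], vector [0, 0, 1]]"
    using ep_rational [of 0 0] that by (simp add: ep_power_1 rot_0)
  have ii: "?L0 = {e1} \<and> ?L1 = {e1} \<and> ?L2 = proj_line e1 e2"
    if "g = vector [vector [1, 1, 0], vector [0, 1, 1], vector [0, 0, 1]]"
    using et [of 0] that by (simp add: et_power_1 rot_0)
  show ?thesis
    using i ii ep_rational [of \<alpha> \<beta>] ep_irrational [of \<alpha> \<beta>] et [of \<alpha>]
    unfolding ep_power_1 et_power_1 by blast
qed

end
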